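(* Let $1<p<\infty$ and let $V$ be a $d\times d$ matrix weight on $\mathbb{R}^n$ with $V\in\mathcal{ND}$. Then $V^p\in\mathcal{A}_{2p,\infty}$ if and only if $V\in\mathcal{A}_{2,\infty}\cap\mathcal{B}_p$.
   Context: A matrix weight is a (complex) Hermitian positive semidefinite $d\times d$ measurable matrix function $V$ on $\mathbb{R}^n$ with $|V|\in L^1_{loc}(\mathbb{R}^n)$; cubes are axis-parallel. $V\in\mathcal{ND}$: $\int_EV$ is positive definite for every measurable $E$ with $|E|>0$. $V\in\mathcal{B}_p$: $V\in L^p_{loc}$ and there is $C>0$ with $\big(\frac1{|Q|}\int_Q\langle V\vec e,\vec e\rangle^p\big)^{1/p}\le C\big\langle\big(\frac1{|Q|}\int_QV\big)\vec e,\vec e\big\rangle$ for all cubes $Q$ and $\vec e\in\mathbb{C}^d$. For $1<q<\infty$, a matrix weight $W$ is $q$-nondegenerate if for every nonzero $\vec e\in\mathbb{C}^d$, $|W^{1/q}(x)\vec e|>0$ for a.e. $x$. In that case, for each cube $Q$ there is a positive definite Hermitian matrix $R^q_Q(W)$ (a reducing matrix; the choice is immaterial) with $\big(\frac1{|Q|}\int_Q|W^{1/q}(x)\vec e|^qdx\big)^{1/q}\le|R^q_Q(W)\vec e|\le\sqrt d\,\big(\frac1{|Q|}\int_Q|W^{1/q}(x)\vec e|^qdx\big)^{1/q}$ for all $\vec e\in\mathbb{C}^d$. $W\in\mathcal{A}_{q,\infty}$ if $W$ is a $q$-nondegenerate matrix weight and there is $A_W>0$ with $\det R^q_Q(W)\le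 A_W\exp\big(\frac1{|Q|}\int_Q\ln\det W^{1/q}(x)\,dx\big)$ for all cubes $Q$. (For $q=2$ this is $\det\frac1{|Q|}\int_QW\le A\exp\big(\frac1{|Q|}\int_Q\ln\det W\big)$ for all $Q$.) *)

theory Defs
  imports "HOL-Analysis.Analysis"
begin

section \<open>Complex matrices\<close>

definition cinner :: "complex ^ 'd \<Rightarrow> complex ^ 'd \<Rightarrow> complex"
  where "cinner x y = (\<Sum>i\<in>UNIV. x $ i * cnj (y $ i))"

definition conj_transpose :: "complex ^ 'd ^ 'd \<Rightarrow> complex ^ 'd ^ 'd"
  where "conj_transpose A = (\<chi> i j. cnj (A $ j $ i))"

definition hermitian :: "complex ^ 'd ^ 'd \<Rightarrow> bool"
  where "hermitian A \<longleftrightarrow> conj_transpose A = A"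

definition unitary :: "complex ^ 'd ^ 'd \<Rightarrow> bool"
  where "unitary U \<longleftrightarrow> U ** conj_transpose U = mat 1 \<and> conj_transpose U ** U = mat 1"

text \<open>For Hermitian \<open>A\<close> the number \<open>cinner (A *v e) e\<close> is real; \<open>Re\<close> is only a coercion to
  the reals, here and in the quadratic forms and determinants below.\<close>

definition pos_semidef :: "complex ^ 'd ^ 'd \<Rightarrow> bool"
  where "pos_semidef A \<longleftrightarrow> hermitian A \<and> (\<forall>e. 0 \<le> Re (cinner (A *v e) e))"

definition pos_def :: "complex ^ 'd ^ 'd \<Rightarrow> bool"
  where "pos_def A \<longleftrightarrow> hermitian A \<and> (\<forall>e. e \<noteq> 0 \<longrightarrow> 0 < Re (cinner (A *v e) e))"

definition diag_mat :: "real ^ 'd \<Rightarrow> complex ^ 'd ^ 'd"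
  where "diag_mat c = (\<chi> i j. if i = j then complex_of_real (c $ i) else 0)"

text \<open>The power \<open>A\<^sup>r\<close> of a positive semidefinite matrix, by diagonalisation; the result does not
  depend on the diagonalisation. It is used for \<open>r > 0\<close> only, where \<open>0 powr r = 0\<close> is the intended
  value at a zero eigenvalue.\<close>

definition mat_powr :: "complex ^ 'd ^ 'd \<Rightarrow> real \<Rightarrow> complex ^ 'd ^ 'd"
  where "mat_powr A r = (THE B. \<exists>U c. unitary U \<and> (\<forall>i. 0 \<le> c $ i) \<and>
           A = U ** diag_mat c ** conj_transpose U \<and>
           B = U ** diag_mat (\<chi> i. c $ i powr r) ** conj_transpose U)"

abbreviation op_norm :: "complex ^ 'd ^ 'd \<Rightarrow> real"
  where "op_norm A \<equiv> onorm ((*v) A)"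

section \<open>Cubes, averages, local integrability\<close>

definition cube :: "(real ^ 'n) set \<Rightarrow> bool"
  where "cube Q \<longleftrightarrow> (\<exists>a l. 0 < l \<and> Q = cbox a (a + (\<chi> i. l)))"

definition avg :: "(real ^ 'n) set \<Rightarrow> (real ^ 'n \<Rightarrow> 'b::{banach, second_countable_topology}) \<Rightarrow> 'b"
  where "avg Q f = (1 / measure lebesgue Q) *\<^sub>R (LINT x:Q|lebesgue. f x)"

definition locally_integrable :: "(real ^ 'n \<Rightarrow> real) \<Rightarrow> bool"
  where "locally_integrable f \<longleftrightarrow> (\<forall>K. compact K \<longrightarrow> set_integrable lebesgue K f)"

section \<open>Matrix weights\<close>

definition matrix_weight :: "(real ^ 'n \<Rightarrow> complex ^ 'd ^ 'd) \<Rightarrow> bool"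
  where "matrix_weight V \<longleftrightarrow> V \<in> borel_measurable lebesgue \<and> (\<forall>x. pos_semidef (V x)) \<and>
           locally_integrable (\<lambda>x. op_norm (V x))"

text \<open>The integral of a weight over a set of infinite measure may diverge, while the Bochner
  integral would then be \<open>0\<close>; hence the integrability condition on \<open>E\<close>. It loses nothing, because
  every set of positive measure contains a bounded subset of positive measure and the quadratic
  forms \<open>\<langle>V e, e\<rangle>\<close> are nonnegative.\<close>

definition ND :: "(real ^ 'n \<Rightarrow> complex ^ 'd ^ 'd) \<Rightarrow> bool"
  where "ND V \<longleftrightarrow> (\<forall>E. E \<in> sets lebesgue \<and> 0 < emeasure lebesgue E \<and> set_integrable lebesgue E V \<longrightarrow>
           pos_def (LINT x:E|lebesgue. V x))"

definition B_class :: "real \<Rightarrow> (real ^ 'n \<Rightarrow> complex ^ 'd ^ 'd) \<Rightarrow> bool"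
  where "B_class p V \<longleftrightarrow> V \<in> borel_measurable lebesgue \<and>
           locally_integrable (\<lambda>x. op_norm (V x) powr p) \<and>
           (\<exists>C>0. \<forall>Q e. cube Q \<longrightarrow>
              avg Q (\<lambda>x. Re (cinner (V x *v e) e) powr p) powr (1 / p)
                \<le> C * Re (cinner (avg Q V *v e) e))"

definition nondegenerate :: "real \<Rightarrow> (real ^ 'n \<Rightarrow> complex ^ 'd ^ 'd) \<Rightarrow> bool"
  where "nondegenerate q W \<longleftrightarrow>
           (\<forall>e. e \<noteq> 0 \<longrightarrow> (AE x in lebesgue. 0 < norm (mat_powr (W x) (1 / q) *v e)))"

definition is_reducing_matrix ::
    "real \<Rightarrow> (real ^ 'n \<Rightarrow> complex ^ 'd ^ 'd) \<Rightarrow> (real ^ 'n) set \<Rightarrow> complex ^ 'd ^ 'd \<Rightarrow> bool"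
  where "is_reducing_matrix q W Q R \<longleftrightarrow> pos_def R \<and>
           (\<forall>e. avg Q (\<lambda>x. norm (mat_powr (W x) (1 / q) *v e) powr q) powr (1 / q) \<le> norm (R *v e) \<and>
                norm (R *v e) \<le> sqrt (real CARD('d)) *
                  avg Q (\<lambda>x. norm (mat_powr (W x) (1 / q) *v e) powr q) powr (1 / q))"

text \<open>For a \<open>q\<close>-nondegenerate matrix weight such a matrix exists for every cube, by John's
  ellipsoid theorem applied to the norm given by the averages.\<close>

definition reducing_matrix ::
    "real \<Rightarrow> (real ^ 'n \<Rightarrow> complex ^ 'd ^ 'd) \<Rightarrow> (real ^ 'n) set \<Rightarrow> complex ^ 'd ^ 'd"
  where "reducing_matrix q W Q = (SOME R. is_reducing_matrix q W Q R)"

text \<open>\<open>exp (1/|Q| \<integral>\<^sub>Q ln (det M))\<close> with the conventions \<open>ln 0 = -\<infinity>\<close> and \<open>exp (-\<infinity>) = 0\<close>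
  (in HOL \<open>ln 0 = 0\<close>, and the integral of a non-integrable function is \<open>0\<close>). For
  \<open>M = W\<^bsup>1/q\<^esup>\<close> with a matrix weight \<open>W\<close>, \<open>ln (det M)\<close> is bounded above by a multiple of \<open>|W|\<close>, so
  its integral over a cube always exists in \<open>[-\<infinity>, \<infinity>)\<close> and is \<open>-\<infinity>\<close> exactly in the second case.\<close>

definition exp_avg_ln_det :: "(real ^ 'n) set \<Rightarrow> (real ^ 'n \<Rightarrow> complex ^ 'd ^ 'd) \<Rightarrow> real"
  where "exp_avg_ln_det Q M =
           (if (AE x in lebesgue. x \<in> Q \<longrightarrow> 0 < Re (det (M x))) \<and>
               set_integrable lebesgue Q (\<lambda>x. ln (Re (det (M x))))
            then exp (avg Q (\<lambda>x. ln (Re (det (M x))))) else 0)"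

definition A_inf :: "real \<Rightarrow> (real ^ 'n \<Rightarrow> complex ^ 'd ^ 'd) \<Rightarrow> bool"
  where "A_inf q W \<longleftrightarrow> matrix_weight W \<and> nondegenerate q W \<and>
           (\<exists>A>0. \<forall>Q. cube Q \<longrightarrow>
              Re (det (reducing_matrix q W Q)) \<le> A * exp_avg_ln_det Q (\<lambda>x. mat_powr (W x) (1 / q)))"

end

theory Submission imports Defs begin

text \<open>The matrices \<open>(V\<^sup>p)\<^bsup>1/(2p)\<^esup>\<close> and \<open>V\<^bsup>1/2\<^esup>\<close> coincide, so the right-hand sides of the two
\<open>A\<^sub>\<infinity>\<close> conditions are the same number \<open>E(Q)\<close>, and both sides of the equivalence contain the same
nondegeneracy condition. Only the reducing matrices differ: \<open>R = R\<^bsup>2p\<^esup>\<^sub>Q(V\<^sup>p)\<close> is comparable with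
the norm \<open>e \<mapsto> (avg \<langle>Ve,e\<rangle>\<^sup>p)\<^bsup>1/(2p)\<^esup>\<close>, written \<open>weight_norm V p Q\<close> below, and \<open>S = R\<^bsup>2\<^esup>\<^sub>Q(V)\<close> with the same norm
for \<open>p = 1\<close>. Jensen's inequality gives \<open>|Se| \<le> \<surd>d |Re|\<close>, and \<open>\<B>\<^sub>p\<close> says, besides the local
integrability of \<open>|V|\<^sup>p\<close>, that conversely \<open>|Re| \<le> K |Se|\<close> with \<open>K\<close> independent of the cube.

If \<open>V\<close> is in \<open>A\<^bsub>2,\<infinity>\<^esub>\<close> and in \<open>\<B>\<^sub>p\<close>, then \<open>det R \<le> K\<^sup>d det S \<le> K\<^sup>d A E(Q)\<close>
(lemma \<open>norm_det_mono\<close>). Conversely, let \<open>det R \<le> A E(Q)\<close>. Then \<open>det S \<le> d\<^bsup>d/2\<^esup> det R\<close> yields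
\<open>A\<^bsub>2,\<infinity>\<^esub>\<close>. Jensen's inequality for the logarithm of the determinant gives \<open>E(Q) \<le> det S\<close>
(lemma \<open>exp_avg_ln_det_le\<close>), hence \<open>det R \<le> A det S\<close>. Thus all singular values of
\<open>R S\<^bsup>-1\<^esup>\<close> are at least \<open>1/\<surd>d\<close> while their product is at most \<open>A\<close>; so the largest one is bounded
(lemma \<open>norm_le_of_det_le\<close>), which is \<open>|Re| \<le> K |Se|\<close>, that is \<open>\<B>\<^sub>p\<close>.

The reducing matrix is a choice among the matrices with the required property, so the argument
also depends on the existence of one, with the constant \<open>\<surd>d\<close>: this is John's theorem for
norms on \<open>\<complex>\<^sup>d\<close> (\<open>john_ellipsoid\<close>). The other ingredients are the spectral theorem, which makes the
powers of a matrix accessible, and the measurability of \<open>x \<mapsto> V(x)\<^sup>p\<close>.\<close>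

section \<open>Adjoints and unitary matrices\<close>

lemma inner_eq_Re_cinner: "x \<bullet> y = Re (cinner x y)"
  by (simp add: inner_vec_def cinner_def inner_complex_def)

lemma matrix_vector_mult_of_real: "A *v (r *\<^sub>R x) = r *\<^sub>R (A *v x)" for A :: "complex ^ 'd ^ 'd"
  by (intro linear_cmul) simp

lemma matrix_vector_mult_axis: "(A *v axis i 1) $ j = A $ j $ i" for A :: "complex ^ 'd ^ 'd"
  by (simp add: matrix_vector_mult_def axis_def if_distrib cong: if_cong)

lemma inner_adjoint: "(A *v x) \<bullet> y = x \<bullet> (conj_transpose A *v y)"
proof -
  have "cinner (A *v x) y = (\<Sum>i\<in>UNIV. \<Sum>j\<in>UNIV. A $ i $ j * x $ j * cnj (y $ i))"
    by (simp add: cinner_def matrix_vector_mult_def sum_distrib_right)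
  also have "\<dots> = (\<Sum>j\<in>UNIV. \<Sum>i\<in>UNIV. A $ i $ j * x $ j * cnj (y $ i))"
    by (rule sum.swap)
  also have "\<dots> = cinner x (conj_transpose A *v y)"
    by (simp add: cinner_def matrix_vector_mult_def conj_transpose_def sum_distrib_left mult_ac)
  finally show ?thesis
    by (simp add: inner_eq_Re_cinner)
qed

lemma conj_transpose_conj_transpose [simp]: "conj_transpose (conj_transpose A) = A"
  by (simp add: conj_transpose_def vec_eq_iff)

lemma conj_transpose_mat_1 [simp]: "conj_transpose (mat 1) = mat 1"
  by (simp add: conj_transpose_def vec_eq_iff mat_def)

lemma conj_transpose_mult: "conj_transpose (A ** B) = conj_transpose B ** conj_transpose A"
  by (simp add: conj_transpose_def vec_eq_iff matrix_matrix_mult_def mult.commute)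

lemma conj_transpose_diag_mat [simp]: "conj_transpose (diag_mat c) = diag_mat c"
  by (simp add: conj_transpose_def vec_eq_iff diag_mat_def)

lemma det_conj_transpose: "det (conj_transpose A) = cnj (det A)"
proof -
  have "det (conj_transpose A) = det (\<chi> i j. cnj (A $ i $ j))"
    by (subst det_transpose [symmetric]) (simp add: transpose_def conj_transpose_def)
  also have "\<dots> = cnj (det A)"
    by (simp add: det_def)
  finally show ?thesis .
qed

lemma diag_mat_mult_vec: "diag_mat c *v x = (\<chi> i. of_real (c $ i) * x $ i)"
  by (simp add: diag_mat_def matrix_vector_mult_def vec_eq_iff if_distrib [of "\<lambda>z. z * _"] cong: if_cong)

lemma diag_mat_mult_axis: "diag_mat c *v axis i 1 = c $ i *\<^sub>R axis i 1"
  by (auto simp: diag_mat_mult_vec vec_eq_iff axis_def of_real_def)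

lemma diag_mat_mult: "diag_mat c ** diag_mat c' = diag_mat (\<chi> i. c $ i * c' $ i)"
  by (simp add: matrix_eq diag_mat_mult_vec vec_eq_iff flip: matrix_vector_mul_assoc)

lemma det_diag_mat: "det (diag_mat c) = of_real (\<Prod>i\<in>UNIV. c $ i)"
  by (subst det_diagonal) (auto simp: diag_mat_def)

lemma norm_eq_inner_adjoint: "(norm (A *v x))\<^sup>2 = x \<bullet> ((conj_transpose A ** A) *v x)"
  by (simp add: power2_norm_eq_inner inner_adjoint matrix_vector_mul_assoc)

lemma unitary_mult: "unitary U \<Longrightarrow> unitary W \<Longrightarrow> unitary (U ** W)"
  unfolding unitary_def conj_transpose_mult
  by (metis matrix_mul_assoc matrix_mul_rid)

lemma unitary_conj_transpose: "unitary U \<Longrightarrow> unitary (conj_transpose U)"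
  by (simp add: unitary_def)

lemma unitary_mat_1 [simp]: "unitary (mat 1)"
  by (simp add: unitary_def)

lemma unitary_cancel:
  assumes "unitary U"
  shows "U *v (conj_transpose U *v x) = x" "conj_transpose U *v (U *v x) = x"
    "U ** (conj_transpose U ** A) = A" "conj_transpose U ** (U ** A) = A"
    "A ** U ** conj_transpose U = A" "A ** conj_transpose U ** U = A"
    "U ** conj_transpose U = mat 1" "conj_transpose U ** U = mat 1"
proof -
  have U: "U ** conj_transpose U = mat 1" "conj_transpose U ** U = mat 1"
    using assms by (auto simp: unitary_def)
  then show "U ** conj_transpose U = mat 1" "conj_transpose U ** U = mat 1" .
  show "U *v (conj_transpose U *v x) = x" "conj_transpose U *v (U *v x) = x"
    "U ** (conj_transpose U ** A) = A" "conj_transpose U ** (U ** A) = A"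
    by (simp_all add: U matrix_vector_mul_assoc matrix_mul_assoc)
  show "A ** U ** conj_transpose U = A" "A ** conj_transpose U ** U = A"
    by (simp_all add: U flip: matrix_mul_assoc)
qed

lemma norm_unitary: "unitary U \<Longrightarrow> norm (U *v x) = norm x"
  by (simp add: norm_eq_sqrt_inner inner_adjoint unitary_cancel)

lemma norm_det_unitary: "unitary U \<Longrightarrow> norm (det U) = 1"
proof -
  assume "unitary U"
  then have "det U * cnj (det U) = 1"
    by (metis det_I det_conj_transpose det_mul unitary_def)
  then have "(norm (det U))\<^sup>2 = 1"
    by (metis complex_norm_square of_real_eq_1_iff of_real_power)
  then show ?thesis
    using norm_ge_zero[of "det U"] by (auto simp: power2_eq_1_iff)
qed

lemma norm_axis_one [simp]: "norm (axis i 1 :: complex ^ 'd) = 1"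
  by (simp add: norm_eq_sqrt_inner inner_axis_axis)

lemma norm_vec_sq: "(norm x)\<^sup>2 = (\<Sum>i\<in>UNIV. (norm (x $ i))\<^sup>2)"
  by (simp add: norm_vec_def L2_set_def sum_nonneg)

lemma norm_matrix_sq:
  fixes A :: "complex ^ 'd ^ 'd"
  shows "(norm A)\<^sup>2 = (\<Sum>i\<in>UNIV. (norm (A *v axis i 1))\<^sup>2)"
  by (simp add: norm_vec_sq matrix_vector_mult_axis) (rule sum.swap)

text \<open>Reflecting along \<open>e\<^sub>k - zx\<close> swaps \<open>e\<^sub>k\<close> and \<open>zx\<close> and fixes every vector orthogonal to both. Over the
complex numbers this works only if the inner product of \<open>zx\<close> and \<open>e\<^sub>k\<close> is real, whence the phase
\<open>z\<close>. The set \<open>K\<close> lets an induction keep the basis vectors that have already been treated.\<close>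

lemma householder_exists:
  fixes x :: "complex ^ 'd"
  assumes x: "norm x = 1" and supp: "\<And>i. i \<in> K \<Longrightarrow> x $ i = 0" and k: "k \<notin> K"
  obtains H z where "unitary H" "norm z = 1" "H *v axis k 1 = z *s x"
    "\<And>i. i \<in> K \<Longrightarrow> H *v axis i 1 = axis i 1"
proof -
  define z where "z = (if x $ k = 0 then 1 else cnj (x $ k) / of_real (norm (x $ k)))"
  define y where "y = z *s x"
  have z: "norm z = 1"
    by (simp add: z_def norm_divide)
  have yk: "y $ k = of_real (norm (x $ k))"
    by (simp add: y_def z_def complex_norm_square[symmetric] power2_eq_square field_simps)
  have sq_y: "(\<Sum>i\<in>UNIV. y $ i * cnj (y $ i)) = 1"
  proof -
    have "(\<Sum>i\<in>UNIV. y $ i * cnj (y $ i)) = (\<Sum>i\<in>UNIV. of_real ((norm (y $ i))\<^sup>2))"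
      by (simp only: complex_norm_square)
    also have "\<dots> = of_real (\<Sum>i\<in>UNIV. (norm (x $ i))\<^sup>2)"
      using z by (simp add: y_def norm_mult)
    also have "(\<Sum>i\<in>UNIV. (norm (x $ i))\<^sup>2) = (norm x)\<^sup>2"
      by (simp add: norm_vec_def L2_set_def sum_nonneg)
    finally show ?thesis using x by simp
  qed
  define w where "w = axis k 1 - y"
  \<comment> \<open>\<open>s\<close> is the squared norm of \<open>w\<close>; the value \<open>t = 0\<close> below makes \<open>H\<close> the identity if \<open>w = 0\<close>.\<close>
  define s where "s = 2 * (1 - y $ k)"
  have s: "(\<Sum>i\<in>UNIV. w $ i * cnj (w $ i)) = s"
  proof -
    have "(\<Sum>i\<in>UNIV. w $ i * cnj (w $ i)) = (\<Sum>i\<in>UNIV. y $ i * cnj (y $ i) +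
        (if i = k then 1 - y $ k - cnj (y $ k) else 0))"
      by (rule sum.cong) (auto simp: w_def axis_def algebra_simps)
    also have "\<dots> = s"
      using yk by (simp add: sum.distrib sq_y s_def)
    finally show ?thesis .
  qed
  define P where "P = (\<chi> i j. w $ i * cnj (w $ j))"
  define t where "t = (if s = 0 then 0 else 2 / s)"
  define H where "H = mat 1 - (\<chi> i j. t * P $ i $ j)"
  have cs: "cnj s = s" by (simp add: s_def yk)
  then have ct: "cnj t = t" by (simp add: t_def)
  have w0: "w = 0" if "s = 0"
  proof -
    have "of_real (\<Sum>i\<in>UNIV. (norm (w $ i))\<^sup>2) = (0::complex)"
      using s that by (simp flip: complex_norm_square)
    then have "(\<Sum>i\<in>UNIV. (norm (w $ i))\<^sup>2) = 0"
      by (simp only: of_real_eq_0_iff)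
    then show ?thesis
      by (simp add: sum_nonneg_eq_0_iff vec_eq_iff)
  qed
  have H_vec: "(H *v v) $ i = v $ i - t * w $ i * (\<Sum>j\<in>UNIV. cnj (w $ j) * v $ j)" for v i
  proof -
    have "H *v v = mat 1 *v v - (\<chi> i j. t * P $ i $ j) *v v"
      unfolding H_def by (rule matrix_vector_mult_diff_rdistrib)
    then have "H *v v = v - (\<chi> i j. t * P $ i $ j) *v v"
      by simp
    then show ?thesis
      by (simp add: vec_eq_iff) (simp add: matrix_vector_mult_def P_def sum_distrib_left mult_ac)
  qed
  have herm: "conj_transpose H = H"
    by (simp add: H_def P_def conj_transpose_def vec_eq_iff mat_def ct)
  have "H *v (H *v v) = v" for v
  proof -
    define m where "m = (\<Sum>j\<in>UNIV. cnj (w $ j) * v $ j)"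
    have "(\<Sum>j\<in>UNIV. cnj (w $ j) * (H *v v) $ j) = m - t * m * s"
    proof -
      have "(\<Sum>j\<in>UNIV. cnj (w $ j) * (H *v v) $ j)
          = (\<Sum>j\<in>UNIV. cnj (w $ j) * v $ j - t * m * (w $ j * cnj (w $ j)))"
        by (rule sum.cong) (auto simp: H_vec m_def algebra_simps)
      then show ?thesis
        by (simp add: sum_subtractf m_def s flip: sum_distrib_left)
    qed
    then have "(H *v (H *v v)) $ i = v $ i - t * w $ i * m - t * w $ i * (m - t * m * s)" for i
      by (simp add: H_vec[of "H *v v"]) (simp add: H_vec m_def)
    moreover have "t * w $ i * m + t * w $ i * (m - t * m * s) = 0" for i
      by (auto simp: t_def field_simps)
    ultimately show ?thesis
      unfolding vec_eq_iff by (metis (no_types) diff_diff_eq diff_zero)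
  qed
  then have "H ** H = mat 1"
    by (simp add: matrix_eq matrix_vector_mul_assoc)
  then have "unitary H"
    by (simp add: unitary_def herm)
  moreover have "H *v axis k 1 = z *s x"
  proof -
    have "(\<Sum>j\<in>UNIV. cnj (w $ j) * axis k 1 $ j) = cnj (w $ k)"
      by (simp add: axis_def if_distrib cong: if_cong)
    also have "\<dots> = 1 - y $ k"
      by (simp add: w_def yk)
    finally have "(H *v axis k 1) $ i = axis k 1 $ i - t * w $ i * (1 - y $ k)" for i
      by (simp add: H_vec)
    moreover have yk2: "1 - y $ k = s / 2"
      by (simp add: s_def)
    have "t * w $ i * (1 - y $ k) = w $ i" for i
      unfolding yk2 using w0 by (cases "s = 0") (auto simp: t_def)
    ultimately have "(H *v axis k 1) $ i = axis k 1 $ i - w $ i" for i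
      by simp
    then show ?thesis
      by (simp add: vec_eq_iff w_def y_def)
  qed
  moreover have "H *v axis i 1 = axis i 1" if "i \<in> K" for i
  proof -
    have "(\<Sum>j\<in>UNIV. cnj (w $ j) * axis i 1 $ j) = cnj (w $ i)"
      by (simp add: axis_def if_distrib cong: if_cong)
    also have "w $ i = 0"
      using that k supp by (auto simp: w_def y_def axis_def)
    finally show ?thesis
      by (simp add: vec_eq_iff H_vec)
  qed
  ultimately show ?thesis
    using that z by blast
qed

section \<open>The spectral theorem and powers of matrices\<close>

lemma hermitian_inner: "hermitian A \<Longrightarrow> (A *v x) \<bullet> y = x \<bullet> (A *v y)"
  by (simp add: hermitian_def inner_adjoint)

text \<open>The basis vectors in \<open>K\<close> are eigenvectors, so their orthogonal complement \<open>S\<close> is invariant. A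
maximiser \<open>x\<close> of the quadratic form on the unit sphere of \<open>S\<close>, with maximum \<open>r\<close>, is an
eigenvector: the form \<open>r |y|\<^sup>2 - \<langle>Ay, y\<rangle>\<close> is nonnegative on \<open>S\<close> and vanishes at \<open>x\<close>, so its first
variation at \<open>x\<close> in the direction \<open>h = rx - Ax\<close>, which is \<open>2 |h|\<^sup>2\<close>, must vanish as well.\<close>

lemma hermitian_eigenvector_exists:
  fixes A :: "complex ^ 'd ^ 'd"
  assumes A: "hermitian A" and K: "\<And>i. i \<in> K \<Longrightarrow> \<exists>r::real. A *v axis i 1 = r *\<^sub>R axis i 1"
    and k: "k \<notin> K"
  obtains x and r :: real where "norm x = 1" "\<And>i. i \<in> K \<Longrightarrow> x $ i = 0" "A *v x = r *\<^sub>R x"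
proof -
  define S where "S = {x :: complex ^ 'd. \<forall>i\<in>K. x $ i = 0}"
  have inv: "A *v x \<in> S" if "x \<in> S" for x
  proof -
    have "(A *v x) $ i = 0" if i: "i \<in> K" for i
    proof -
      obtain r where r: "A *v axis i 1 = r *\<^sub>R axis i 1" using K i by blast
      have "a \<bullet> (A *v x) $ i = 0" for a
      proof -
        have "axis i a = a *s axis i 1"
          by (simp add: vec_eq_iff axis_def)
        then have "A *v axis i a = A *v (a *s axis i 1)"
          by simp
        also have "\<dots> = a *s (r *\<^sub>R axis i 1)"
          by (simp only: vector_scalar_commute r)
        also have "\<dots> = r *\<^sub>R axis i a"
          by (simp add: vec_eq_iff axis_def)
        finally have "(A *v axis i a) \<bullet> x = 0"
          using \<open>x \<in> S\<close> i by (simp add: S_def inner_axis')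
        then have "axis i a \<bullet> (A *v x) = 0"
          using hermitian_inner[OF A] by simp
        then show ?thesis
          by (simp add: inner_axis' inner_commute)
      qed
      then show ?thesis by (metis inner_eq_zero_iff)
    qed
    then show ?thesis by (simp add: S_def)
  qed
  have "closed S"
    unfolding S_def Ball_def by (intro closed_Collect_all closed_Collect_imp closed_Collect_eq continuous_intros) auto
  then have "compact (S \<inter> sphere 0 1)"
    by (metis Int_commute compact_Int_closed compact_sphere)
  moreover have "axis k 1 \<in> S \<inter> sphere 0 1"
    using k by (auto simp: S_def axis_def norm_vec_def L2_set_def if_distrib[of norm] if_distrib[of "\<lambda>x. x\<^sup>2"] cong: if_cong)
  moreover have "continuous_on (S \<inter> sphere 0 1) (\<lambda>x. (A *v x) \<bullet> x)"
    by (intro continuous_intros linear_continuous_on matrix_vector_mul_bounded_linear)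
  ultimately have "\<exists>x\<in>S \<inter> sphere 0 1. \<forall>y\<in>S \<inter> sphere 0 1. (A *v y) \<bullet> y \<le> (A *v x) \<bullet> x"
    by (intro continuous_attains_sup) auto
  then obtain x where x: "x \<in> S" "norm x = 1"
    and max: "\<And>y. y \<in> S \<Longrightarrow> norm y = 1 \<Longrightarrow> (A *v y) \<bullet> y \<le> (A *v x) \<bullet> x"
    by auto
  define r where "r = (A *v x) \<bullet> x"
  have scale: "S \<noteq> {}" "a *\<^sub>R y \<in> S" "y + y' \<in> S" "y - y' \<in> S" if "y \<in> S" "y' \<in> S" for a y y'
    using that by (auto simp: S_def)
  have le: "(A *v y) \<bullet> y \<le> r * (y \<bullet> y)" if "y \<in> S" for y
  proof (cases "y = 0")
    case False
    then have "(A *v (y /\<^sub>R norm y)) \<bullet> (y /\<^sub>R norm y) \<le> r"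
      unfolding r_def using that scale by (intro max) auto
    then show ?thesis
      using False by (simp add: matrix_vector_mult_of_real field_simps flip: power2_norm_eq_inner) 
        (simp add: field_simps power2_eq_square)
  qed simp
  define h where "h = r *\<^sub>R x - A *v x"
  have hS: "h \<in> S" using inv x scale by (auto simp: h_def)
  define g where "g = r * (h \<bullet> h) - (A *v h) \<bullet> h"
  have pos: "0 \<le> 2 * a * (h \<bullet> h) + a\<^sup>2 * g" for a
  proof -
    have 1: "(A *v (x + a *\<^sub>R h)) \<bullet> (x + a *\<^sub>R h) \<le> r * ((x + a *\<^sub>R h) \<bullet> (x + a *\<^sub>R h))"
      using x hS scale by (intro le) auto
    have 2: "(A *v (x + a *\<^sub>R h)) \<bullet> (x + a *\<^sub>R h)
        = r + 2 * a * ((A *v x) \<bullet> h) + a\<^sup>2 * ((A *v h) \<bullet> h)"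
      using hermitian_inner[OF A, of h x]
      by (simp add: matrix_vector_right_distrib matrix_vector_mult_of_real inner_add_left
          inner_add_right r_def inner_commute algebra_simps power2_eq_square)
    have 3: "(x + a *\<^sub>R h) \<bullet> (x + a *\<^sub>R h) = 1 + 2 * a * (x \<bullet> h) + a\<^sup>2 * (h \<bullet> h)"
      using x by (simp add: norm_eq_1 inner_add_left inner_add_right inner_commute algebra_simps power2_eq_square)
    have 4: "2 * a * (h \<bullet> h) = 2 * a * (r * (x \<bullet> h) - (A *v x) \<bullet> h)"
      unfolding h_def by (simp add: inner_diff_left)
    show ?thesis
      using 1 4 unfolding 2 3 g_def by (simp add: algebra_simps)
  qed
  have "h \<bullet> h = 0"
  proof (rule ccontr)
    assume "h \<bullet> h \<noteq> 0"
    then have hh: "h \<bullet> h > 0" by simp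
    define G where "G = \<bar>g\<bar> + 1"
    have G: "G > 0" "g < G" by (auto simp: G_def)
    \<comment> \<open>a small negative multiple of \<open>h\<close> makes the linear term dominate\<close>
    have "0 \<le> 2 * (- (h \<bullet> h) / G) * (h \<bullet> h) + (- (h \<bullet> h) / G)\<^sup>2 * g"
      by (rule pos)
    also have "\<dots> = (h \<bullet> h)\<^sup>2 / G * (g / G - 2)"
      using G by (simp add: field_simps power2_eq_square)
    finally have "0 \<le> (h \<bullet> h)\<^sup>2 / G * (g / G - 2)" .
    moreover have "0 < (h \<bullet> h)\<^sup>2 / G"
      using hh G by simp
    ultimately have "0 \<le> g / G - 2"
      by (metis zero_le_mult_iff not_less)
    then show False using G by (simp add: field_simps)
  qed
  then have "A *v x = r *\<^sub>R x" by (simp add: h_def)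
  then show ?thesis using that x by (auto simp: S_def)
qed

text \<open>The dimension is a type and admits no induction, so the induction runs over the set \<open>K\<close> of those
basis vectors that are eigenvectors of the conjugated matrix; a reflection moves a new eigenvector,
orthogonal to \<open>K\<close>, onto the next basis vector.\<close>

theorem hermitian_diagonalisation:
  fixes A :: "complex ^ 'd ^ 'd"
  assumes A: "hermitian A"
  obtains U c where "unitary U" "A = U ** diag_mat c ** conj_transpose U"
proof -
  have "\<exists>U. unitary U \<and> (\<forall>i\<in>K. \<exists>r::real. (conj_transpose U ** A ** U) *v axis i 1 = r *\<^sub>R axis i 1)"
    if "finite K" for K :: "'d set"
    using that
  proof induction
    case empty
    show ?case by (intro exI[of _ "mat 1"]) simp
  next
    case (insert k K)
    then obtain U where U: "unitary U"
      and KU: "\<And>i. i \<in> K \<Longrightarrow> \<exists>r::real. (conj_transpose U ** A ** U) *v axis i 1 = r *\<^sub>R axis i 1"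
      by blast
    define B where "B = conj_transpose U ** A ** U"
    have B: "hermitian B"
      using A by (simp add: B_def hermitian_def conj_transpose_mult matrix_mul_assoc)
    obtain x and r :: real where x: "norm x = 1" "\<And>i. i \<in> K \<Longrightarrow> x $ i = 0" "B *v x = r *\<^sub>R x"
      using hermitian_eigenvector_exists[OF B, of K k] KU insert.hyps by (metis B_def)
    obtain H z where H: "unitary H" "H *v axis k 1 = z *s x"
      "\<And>i. i \<in> K \<Longrightarrow> H *v axis i 1 = axis i 1"
      using householder_exists[of x K k] x insert.hyps by metis
    have *: "(conj_transpose (U ** H) ** A ** (U ** H)) *v v = conj_transpose H *v (B *v (H *v v))" for v
      by (simp add: B_def conj_transpose_mult matrix_vector_mul_assoc matrix_mul_assoc)
    have "\<exists>r::real. (conj_transpose (U ** H) ** A ** (U ** H)) *v axis i 1 = r *\<^sub>R axis i 1"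
      if "i \<in> insert k K" for i
    proof -
      have "\<exists>r::real. B *v (H *v axis i 1) = r *\<^sub>R (H *v axis i 1)"
      proof (cases "i = k")
        case True
        have "B *v (z *s x) = z *s (B *v x)"
          by (simp add: vec_eq_iff matrix_vector_mult_def sum_distrib_left mult_ac)
        also have "\<dots> = r *\<^sub>R (z *s x)"
          by (simp add: x vec_eq_iff)
        finally show ?thesis using True H by auto
      next
        case False
        then show ?thesis using that H KU by (auto simp: B_def)
      qed
      then obtain r :: real where "B *v (H *v axis i 1) = r *\<^sub>R (H *v axis i 1)" ..
      then have "conj_transpose H *v (B *v (H *v axis i 1)) = r *\<^sub>R axis i 1"
        by (simp only: matrix_vector_mult_of_real unitary_cancel(2)[OF H(1)])
      then show ?thesis using * by metis
    qed
    then show ?case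
      using U H by (intro exI[of _ "U ** H"]) (auto intro: unitary_mult)
  qed
  from this[of UNIV] obtain U where U: "unitary U"
    and "\<forall>i. \<exists>r::real. (conj_transpose U ** A ** U) *v axis i 1 = r *\<^sub>R axis i 1"
    by auto
  then obtain c where c: "\<And>i. (conj_transpose U ** A ** U) *v axis i 1 = (c i::real) *\<^sub>R axis i 1"
    by metis
  have "(conj_transpose U ** A ** U) $ j $ i = diag_mat (\<chi> i. c i) $ j $ i" for i j
  proof -
    have "(conj_transpose U ** A ** U) $ j $ i = (c i *\<^sub>R axis i 1) $ j"
      using arg_cong[OF c[of i], of "\<lambda>v. v $ j"]
      by (simp only: matrix_vector_mult_axis)
    then show ?thesis
      by (auto simp: axis_def diag_mat_def of_real_def)
  qed
  then have "conj_transpose U ** A ** U = diag_mat (\<chi> i. c i)" by (simp add: vec_eq_iff)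
  then have "A = U ** diag_mat (\<chi> i. c i) ** conj_transpose U"
    using U by (metis unitary_cancel(3,5) matrix_mul_assoc)
  then show ?thesis using that U by blast
qed

text \<open>The transition matrix \<open>M\<close> between two diagonalisations intertwines the diagonal matrices, so
\<open>M\<^sub>i\<^sub>j \<noteq> 0\<close> forces \<open>c\<^sub>j = d\<^sub>i\<close>. Hence it also intertwines their images under any function \<open>f\<close>: the functional
calculus does not depend on the diagonalisation.\<close>

lemma unitary_diagonalisation_unique:
  assumes U: "unitary U" and W: "unitary W"
    and eq: "U ** diag_mat c ** conj_transpose U = W ** diag_mat d ** conj_transpose W"
  shows "U ** diag_mat (\<chi> i. f (c $ i)) ** conj_transpose U
    = W ** diag_mat (\<chi> i. f (d $ i)) ** conj_transpose W"
proof -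
  define M where "M = conj_transpose W ** U"
  have entries: "(M ** diag_mat a) $ i $ j = M $ i $ j * of_real (a $ j)"
    "(diag_mat a ** M) $ i $ j = of_real (a $ i) * M $ i $ j" for a i j
    by (simp_all add: matrix_matrix_mult_def diag_mat_def if_distrib [of "\<lambda>z. z * _"]
        if_distrib [of "\<lambda>z. _ * z"] cong: if_cong)
  have "M ** diag_mat c = conj_transpose W ** (U ** diag_mat c ** conj_transpose U) ** U"
    by (simp add: M_def matrix_mul_assoc unitary_cancel U)
  also have "\<dots> = diag_mat d ** M"
    by (simp add: eq M_def matrix_mul_assoc unitary_cancel W)
  finally have "M $ i $ j * of_real (c $ j) = of_real (d $ i) * M $ i $ j" for i j
    by (metis entries)
  then have "M $ i $ j * of_real (f (c $ j)) = of_real (f (d $ i)) * M $ i $ j" for i j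
    by (metis mult.commute mult_cancel_left of_real_eq_iff)
  then have M: "M ** diag_mat (\<chi> i. f (c $ i)) = diag_mat (\<chi> i. f (d $ i)) ** M"
    by (simp add: vec_eq_iff entries)
  have "U ** diag_mat (\<chi> i. f (c $ i)) ** conj_transpose U
      = W ** (M ** diag_mat (\<chi> i. f (c $ i))) ** conj_transpose U"
    by (simp add: M_def unitary_cancel W flip: matrix_mul_assoc)
  also have "\<dots> = W ** diag_mat (\<chi> i. f (d $ i)) ** conj_transpose W"
    unfolding M by (simp add: M_def matrix_mul_assoc unitary_cancel U)
  finally show ?thesis .
qed

lemma mat_powr_eq:
  assumes "unitary U" "\<And>i. 0 \<le> c $ i"
  shows "mat_powr (U ** diag_mat c ** conj_transpose U) r
    = U ** diag_mat (\<chi> i. c $ i powr r) ** conj_transpose U"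
  unfolding mat_powr_def
proof (rule the_equality)
  show "\<exists>W d. unitary W \<and> (\<forall>i. 0 \<le> d $ i) \<and>
      U ** diag_mat c ** conj_transpose U = W ** diag_mat d ** conj_transpose W \<and>
      U ** diag_mat (\<chi> i. c $ i powr r) ** conj_transpose U
        = W ** diag_mat (\<chi> i. d $ i powr r) ** conj_transpose W"
    using assms by blast
next
  fix B
  assume "\<exists>W d. unitary W \<and> (\<forall>i. 0 \<le> d $ i) \<and>
      U ** diag_mat c ** conj_transpose U = W ** diag_mat d ** conj_transpose W \<and>
      B = W ** diag_mat (\<chi> i. d $ i powr r) ** conj_transpose W"
  then show "B = U ** diag_mat (\<chi> i. c $ i powr r) ** conj_transpose U"
    using unitary_diagonalisation_unique[of U _ c _ "\<lambda>t. t powr r"] assms by metis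
qed

lemma inner_diagonalised:
  "((U ** diag_mat c ** conj_transpose U) *v x) \<bullet> x
    = (\<Sum>i\<in>UNIV. c $ i * (norm ((conj_transpose U *v x) $ i))\<^sup>2)"
proof -
  have "((U ** diag_mat c ** conj_transpose U) *v x) \<bullet> x
      = (diag_mat c *v (conj_transpose U *v x)) \<bullet> (conj_transpose U *v x)"
    by (simp add: inner_adjoint flip: matrix_vector_mul_assoc)
  also have "\<dots> = (\<Sum>i\<in>UNIV. c $ i * (norm ((conj_transpose U *v x) $ i))\<^sup>2)"
    by (simp add: diag_mat_mult_vec inner_vec_def power2_norm_eq_inner)
       (simp add: inner_complex_def algebra_simps)
  finally show ?thesis .
qed

lemma inner_diagonalised_axis:
  assumes "unitary U"
  shows "((U ** diag_mat c ** conj_transpose U) *v (U *v axis i 1)) \<bullet> (U *v axis i 1) = c $ i"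
proof -
  have "(diag_mat c *v axis i 1) \<bullet> axis i 1 = c $ i"
    by (simp add: diag_mat_mult_axis inner_axis_axis)
  then show ?thesis
    using assms by (simp add: inner_adjoint unitary_cancel flip: matrix_vector_mul_assoc)
qed

lemma hermitian_diagonalised: "hermitian (U ** diag_mat c ** conj_transpose U)"
  by (simp add: hermitian_def conj_transpose_mult matrix_mul_assoc)

lemma pos_semidef_diagonalisation:
  assumes "pos_semidef A"
  obtains U c where "unitary U" "\<And>i. 0 \<le> c $ i" "A = U ** diag_mat c ** conj_transpose U"
proof -
  obtain U c where U: "unitary U" "A = U ** diag_mat c ** conj_transpose U"
    using assms hermitian_diagonalisation by (metis pos_semidef_def)
  moreover have "0 \<le> c $ i" for i
    using assms inner_diagonalised_axis[OF U(1), of c i]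
    by (metis U(2) inner_eq_Re_cinner pos_semidef_def)
  ultimately show ?thesis using that by blast
qed

lemma pos_semidef_diagonalised:
  "(\<And>i. 0 \<le> c $ i) \<Longrightarrow> pos_semidef (U ** diag_mat c ** conj_transpose U)"
  by (auto simp: pos_semidef_def hermitian_diagonalised inner_diagonalised
      simp flip: inner_eq_Re_cinner intro!: sum_nonneg)

lemma pos_semidef_mat_powr: "pos_semidef A \<Longrightarrow> pos_semidef (mat_powr A r)"
  by (metis (mono_tags, lifting) mat_powr_eq pos_semidef_diagonalisation pos_semidef_diagonalised powr_ge_zero vec_lambda_beta)

lemma mat_powr_mat_powr:
  assumes "pos_semidef A"
  shows "mat_powr (mat_powr A r) s = mat_powr A (r * s)"
proof -
  obtain U c where U: "unitary U" "\<And>i. 0 \<le> c $ i" "A = U ** diag_mat c ** conj_transpose U"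
    using pos_semidef_diagonalisation[OF assms] by blast
  then show ?thesis by (simp add: mat_powr_eq powr_powr)
qed

lemma mat_powr_1:
  assumes "pos_semidef A"
  shows "mat_powr A 1 = A"
proof -
  obtain U c where U: "unitary U" "\<And>i. 0 \<le> c $ i" "A = U ** diag_mat c ** conj_transpose U"
    using pos_semidef_diagonalisation[OF assms] by blast
  have "(\<chi> i. c $ i powr 1) = c"
    using U(2) by (simp add: vec_eq_iff)
  then show ?thesis
    using mat_powr_eq[OF U(1,2), of 1] by (simp add: U(3))
qed

lemma norm_mat_powr_half:
  assumes "pos_semidef A"
  shows "(norm (mat_powr A (1 / 2) *v x))\<^sup>2 = Re (cinner (A *v x) x)"
proof -
  obtain U c where U: "unitary U" "\<And>i. 0 \<le> c $ i" "A = U ** diag_mat c ** conj_transpose U"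
    using pos_semidef_diagonalisation[OF assms] by blast
  let ?B = "mat_powr A (1 / 2)"
  have B: "?B = U ** diag_mat (\<chi> i. c $ i powr (1 / 2)) ** conj_transpose U"
    using U by (simp add: mat_powr_eq)
  have "?B ** ?B = U ** (diag_mat (\<chi> i. c $ i powr (1 / 2)) ** diag_mat (\<chi> i. c $ i powr (1 / 2)))
      ** conj_transpose U"
    unfolding B using U by (simp add: matrix_mul_assoc unitary_cancel)
  also have "\<dots> = A"
    using U by (simp add: diag_mat_mult flip: powr_add)
  finally have "?B ** ?B = A" .
  moreover have "hermitian ?B"
    using B hermitian_diagonalised by simp
  ultimately show ?thesis
    by (simp add: norm_eq_inner_adjoint hermitian_def inner_commute flip: inner_eq_Re_cinner)
qed

lemma det_diagonalised:
  assumes "unitary U"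
  shows "det (U ** diag_mat c ** conj_transpose U) = of_real (\<Prod>i\<in>UNIV. c $ i)"
proof -
  have "det U * det (conj_transpose U) = 1"
    using assms by (metis det_I det_mul unitary_def)
  then show ?thesis
    by (simp add: det_mul det_diag_mat algebra_simps)
qed

lemma det_pos_semidef: "pos_semidef A \<Longrightarrow> det A = of_real (norm (det A))"
  by (metis (no_types, lifting) det_diagonalised norm_of_real abs_of_nonneg prod_nonneg pos_semidef_diagonalisation)

lemma pos_def_imp_pos_semidef: "pos_def A \<Longrightarrow> pos_semidef A"
  unfolding pos_def_def pos_semidef_def
  by (metis inner_eq_Re_cinner inner_zero_right less_eq_real_def)

lemma det_pos_def:
  assumes "pos_def A"
  shows "det A = of_real (norm (det A))" "det A \<noteq> 0"
proof -
  show "det A = of_real (norm (det A))"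
    using assms by (intro det_pos_semidef pos_def_imp_pos_semidef)
  have "inj ((*v) A)"
  proof (rule injI)
    fix x y assume "A *v x = A *v y"
    then have "A *v (x - y) = 0" by (simp add: matrix_vector_mult_diff_distrib)
    then have "Re (cinner (A *v (x - y)) (x - y)) = 0" by (simp flip: inner_eq_Re_cinner)
    then show "x = y" using assms by (metis pos_def_def right_minus_eq less_irrefl)
  qed
  then show "det A \<noteq> 0"
    by (metis invertible_det_nz invertible_left_inverse matrix_left_invertible_injective)
qed

lemma op_norm_diagonalised:
  assumes U: "unitary U" and c: "\<And>i. 0 \<le> c $ i"
  shows "op_norm (U ** diag_mat c ** conj_transpose U) = Max (range (($) c))"
proof (rule antisym)
  let ?m = "Max (range (($) c))"
  have m: "c $ i \<le> ?m" for i by simp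
  then have m0: "0 \<le> ?m" using c order_trans by blast
  show "op_norm (U ** diag_mat c ** conj_transpose U) \<le> ?m"
  proof (rule onorm_le)
    fix x
    have "norm ((U ** diag_mat c ** conj_transpose U) *v x) = norm (diag_mat c *v (conj_transpose U *v x))"
      using U by (simp add: norm_unitary flip: matrix_vector_mul_assoc)
    also have "\<dots> \<le> norm (?m *\<^sub>R (conj_transpose U *v x))"
      using m0 m c by (intro norm_le_componentwise_cart) (simp add: diag_mat_mult_vec norm_mult mult_right_mono)
    also have "\<dots> = ?m * norm x"
      using U m0 by (simp add: norm_unitary unitary_conj_transpose)
    finally show "norm ((U ** diag_mat c ** conj_transpose U) *v x) \<le> ?m * norm x" .
  qed
  have "?m \<in> range (($) c)" by (intro Max_in) auto
  then obtain i where i: "?m = c $ i" by (rule rangeE)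
  have "norm ((U ** diag_mat c ** conj_transpose U) *v (U *v axis i 1)) = c $ i"
    using U c by (simp add: norm_unitary unitary_cancel diag_mat_mult_axis flip: matrix_vector_mul_assoc)
  then show "?m \<le> op_norm (U ** diag_mat c ** conj_transpose U)"
    using onorm[OF matrix_vector_mul_bounded_linear, of "U ** diag_mat c ** conj_transpose U" "U *v axis i 1"] i
    by (simp add: norm_unitary[OF U])
qed

lemma op_norm_mat_powr:
  assumes "pos_semidef A" "0 \<le> p"
  shows "op_norm (mat_powr A p) = op_norm A powr p"
proof -
  obtain U c where U: "unitary U" "\<And>i. 0 \<le> c $ i" "A = U ** diag_mat c ** conj_transpose U"
    using pos_semidef_diagonalisation[OF assms(1)] by blast
  have "op_norm (mat_powr A p) = Max (range (\<lambda>i. c $ i powr p))"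
    using U by (simp add: mat_powr_eq op_norm_diagonalised)
  also have "\<dots> = Max (range (($) c)) powr p"
  proof (rule Max_eqI)
    have "Max (range (($) c)) \<in> range (($) c)" by (intro Max_in) auto
    then obtain i where "Max (range (($) c)) = c $ i" by (rule rangeE)
    then show "Max (range (($) c)) powr p \<in> range (\<lambda>i. c $ i powr p)" by simp
  qed (use U assms(2) in \<open>auto intro!: powr_mono2\<close>)
  also have "Max (range (($) c)) = op_norm A"
    using U by (simp add: op_norm_diagonalised)
  finally show ?thesis .
qed

section \<open>Measurability of the matrix power\<close>

lemma continuous_on_conj_transpose [continuous_intros]:
  "continuous_on S f \<Longrightarrow> continuous_on S (\<lambda>x. conj_transpose (f x))"
  unfolding conj_transpose_def by (intro continuous_intros)

lemma continuous_on_matrix_mult [continuous_intros]: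
  fixes f g :: "'a::topological_space \<Rightarrow> complex ^ 'd ^ 'd"
  shows "continuous_on S f \<Longrightarrow> continuous_on S g \<Longrightarrow> continuous_on S (\<lambda>x. f x ** g x)"
  unfolding matrix_matrix_mult_def by (intro continuous_intros)

lemma continuous_on_diag_mat [continuous_intros]:
  "continuous_on S f \<Longrightarrow> continuous_on S (\<lambda>x. diag_mat (f x))"
proof -
  assume f: "continuous_on S f"
  have "continuous_on S (\<lambda>x. if i = j then complex_of_real (f x $ i) else 0)" for i j
    using f by (cases "i = j") (auto intro!: continuous_intros)
  then show ?thesis
    unfolding diag_mat_def by (intro continuous_on_vec_lambda)
qed

lemma compact_unitary: "compact {U :: complex ^ 'd ^ 'd. unitary U}"
proof -
  have "norm U \<le> sqrt (real CARD('d))" if "unitary U" for U :: "complex ^ 'd ^ 'd"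
    using that by (intro real_le_rsqrt) (simp add: norm_matrix_sq norm_unitary)
  then have "bounded {U :: complex ^ 'd ^ 'd. unitary U}"
    by (auto simp: bounded_iff)
  moreover have "closed {U :: complex ^ 'd ^ 'd. unitary U}"
    unfolding unitary_def by (intro closed_Collect_conj closed_Collect_eq continuous_intros)
  ultimately show ?thesis by (simp add: compact_eq_bounded_closed)
qed

text \<open>The preimage of a closed set under the power is a countable union of compact sets: both a
matrix \<open>\<Phi>(U, c) = U diag(c) U\<^sup>*\<close> and its power \<open>\<Psi>(U, c)\<close> depend continuously on \<open>(U, c)\<close>, and the
pairs with \<open>c\<close> in \<open>[0, m]\<^sup>d\<close> form a compact set \<open>K m\<close>, because the unitary group is compact.\<close>

lemma mat_powr_measurable:
  fixes V :: "'a \<Rightarrow> complex ^ 'd ^ 'd"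
  assumes V: "V \<in> borel_measurable M" and psd: "\<And>x. pos_semidef (V x)" and p: "0 < p"
  shows "(\<lambda>x. mat_powr (V x) p) \<in> borel_measurable M"
proof (rule borel_measurableI)
  fix S :: "(complex ^ 'd ^ 'd) set" assume "open S"
  define C where "C = - S"
  have C: "closed C"
    using \<open>open S\<close> by (simp add: C_def closed_def)
  define K :: "nat \<Rightarrow> ((complex ^ 'd ^ 'd) \<times> (real ^ 'd)) set"
    where "K m = {U. unitary U} \<times> cbox 0 (\<chi> i. real m)" for m
  define \<Phi> :: "(complex ^ 'd ^ 'd) \<times> (real ^ 'd) \<Rightarrow> complex ^ 'd ^ 'd"
    where "\<Phi> = (\<lambda>(U, c). U ** diag_mat c ** conj_transpose U)"
  define \<Psi> :: "(complex ^ 'd ^ 'd) \<times> (real ^ 'd) \<Rightarrow> complex ^ 'd ^ 'd"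
    where "\<Psi> = (\<lambda>(U, c). U ** diag_mat (\<chi> i. c $ i powr p) ** conj_transpose U)"
  have K: "compact (K m)" for m
    by (simp add: K_def compact_Times compact_unitary)
  have cont: "continuous_on (K m) \<Phi>" "continuous_on (K m) \<Psi>" for m
    unfolding \<Phi>_def \<Psi>_def split_beta using p
    by (auto intro!: continuous_intros continuous_on_vec_lambda continuous_on_powr' simp: K_def mem_box_cart)
  have K_D: "unitary U \<and> (\<forall>i. 0 \<le> c $ i)" if "(U, c) \<in> K m" for U c m
    using that by (auto simp: K_def mem_box_cart)
  have "(\<lambda>x. mat_powr (V x) p) -` C \<inter> space M
      = V -` (\<Union>m. \<Phi> ` (K m \<inter> \<Psi> -` C)) \<inter> space M" (is "?L = ?R")
  proof (intro set_eqI iffI)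
    fix x assume x: "x \<in> ?L"
    obtain U c where U: "unitary U" "\<And>i. 0 \<le> c $ i" "V x = U ** diag_mat c ** conj_transpose U"
      using pos_semidef_diagonalisation[OF psd] by blast
    obtain m where m: "Max (range (($) c)) \<le> real m"
      using real_arch_simple by blast
    have "c $ i \<le> real m" for i
      using m by (rule order_trans[rotated]) simp
    then have "(U, c) \<in> K m \<inter> \<Psi> -` C" "V x = \<Phi> (U, c)"
      using U x by (auto simp: K_def \<Phi>_def \<Psi>_def mem_box_cart mat_powr_eq)
    then show "x \<in> ?R" using x by blast
  next
    fix x assume "x \<in> ?R"
    then obtain m U c where "(U, c) \<in> K m" "\<Psi> (U, c) \<in> C" "V x = \<Phi> (U, c)" "x \<in> space M"
      by auto
    then show "x \<in> ?L"
      using K_D by (auto simp: \<Phi>_def \<Psi>_def mat_powr_eq)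
  qed
  moreover have "closed (\<Phi> ` (K m \<inter> \<Psi> -` C))" for m
  proof -
    have "closed (K m \<inter> \<Psi> -` C)"
      using continuous_closed_preimage[OF cont(2) _ C] K compact_imp_closed by blast
    then have "compact (K m \<inter> \<Psi> -` C)"
      using compact_Int_closed[OF K[of m]] by (metis Int_left_absorb)
    then show ?thesis
      by (meson cont(1) compact_continuous_image compact_imp_closed continuous_on_subset Int_lower1)
  qed
  then have "(\<Union>m. \<Phi> ` (K m \<inter> \<Psi> -` C)) \<in> sets borel"
    by (intro sets.countable_UN) auto
  ultimately have "(\<lambda>x. mat_powr (V x) p) -` C \<inter> space M \<in> sets M"
    using V by (simp add: measurable_sets)
  moreover have "(\<lambda>x. mat_powr (V x) p) -` S \<inter> space M
      = space M - ((\<lambda>x. mat_powr (V x) p) -` C \<inter> space M)"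
    by (auto simp: C_def)
  ultimately show "(\<lambda>x. mat_powr (V x) p) -` S \<inter> space M \<in> sets M"
    by simp
qed

section \<open>Comparing determinants through singular values\<close>

lemma norm_matrix_unitary:
  fixes A :: "complex ^ 'd ^ 'd"
  assumes "unitary U"
  shows "norm (U ** A) = norm A" "norm (A ** U) = norm A"
proof -
  have left: "norm (W ** B) = norm B" if "unitary W" for W B :: "complex ^ 'd ^ 'd"
  proof -
    have "(norm (W ** B))\<^sup>2 = (norm B)\<^sup>2"
      using that by (simp add: norm_matrix_sq norm_unitary flip: matrix_vector_mul_assoc)
    then show ?thesis by simp
  qed
  have adj: "norm (conj_transpose B) = norm B" for B :: "complex ^ 'd ^ 'd"
  proof -
    have "(norm (conj_transpose B))\<^sup>2 = (norm B)\<^sup>2"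
      by (simp add: norm_vec_sq conj_transpose_def) (rule sum.swap)
    then show ?thesis by simp
  qed
  show "norm (U ** A) = norm A" using left assms by blast
  have "norm (A ** U) = norm (conj_transpose U ** conj_transpose A)"
    by (metis adj conj_transpose_mult)
  then show "norm (A ** U) = norm A"
    using left unitary_conj_transpose[OF assms] adj by simp
qed

text \<open>The entries of \<open>c\<close> are the squares of the singular values of \<open>M\<close>; avoiding roots keeps the
formulas polynomial.\<close>

definition singular_system :: "complex ^ 'd ^ 'd \<Rightarrow> complex ^ 'd ^ 'd \<Rightarrow> real ^ 'd \<Rightarrow> bool"
  where "singular_system M U c \<longleftrightarrow> unitary U \<and> (\<forall>i. 0 \<le> c $ i) \<and>
    conj_transpose M ** M = U ** diag_mat c ** conj_transpose U"

lemma singular_system_exists: "\<exists>U c. singular_system M U c"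
proof -
  have "pos_semidef (conj_transpose M ** M)"
    unfolding pos_semidef_def
  proof (intro conjI allI)
    show "hermitian (conj_transpose M ** M)"
      by (simp add: hermitian_def conj_transpose_mult)
    show "0 \<le> Re (cinner ((conj_transpose M ** M) *v x) x)" for x
      by (simp add: inner_commute flip: inner_eq_Re_cinner norm_eq_inner_adjoint)
  qed
  then obtain U c where "unitary U" "\<And>i. 0 \<le> c $ i"
      "conj_transpose M ** M = U ** diag_mat c ** conj_transpose U"
    using pos_semidef_diagonalisation by blast
  then show ?thesis
    by (auto simp: singular_system_def)
qed

lemma
  fixes M :: "complex ^ 'd ^ 'd"
  assumes sys: "singular_system M U c"
  shows singular_system_norm:
      "(norm (M *v x))\<^sup>2 = (\<Sum>i\<in>UNIV. c $ i * (norm ((conj_transpose U *v x) $ i))\<^sup>2)"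
    and singular_system_value: "c $ i = (norm (M *v (U *v axis i 1)))\<^sup>2"
    and singular_system_det: "(norm (det M))\<^sup>2 = (\<Prod>i\<in>UNIV. c $ i)"
    and singular_system_trace: "(\<Sum>i\<in>UNIV. (norm (M *v axis i 1))\<^sup>2) = (\<Sum>i\<in>UNIV. c $ i)"
proof -
  have U: "unitary U" and A: "conj_transpose M ** M = U ** diag_mat c ** conj_transpose U"
    using sys by (auto simp: singular_system_def)
  have AM: "(norm (M *v x))\<^sup>2 = ((U ** diag_mat c ** conj_transpose U) *v x) \<bullet> x" for x
    by (simp add: norm_eq_inner_adjoint inner_commute flip: A)
  show "(norm (M *v x))\<^sup>2 = (\<Sum>i\<in>UNIV. c $ i * (norm ((conj_transpose U *v x) $ i))\<^sup>2)"
    unfolding AM by (rule inner_diagonalised)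
  show c: "c $ i = (norm (M *v (U *v axis i 1)))\<^sup>2" for i
    unfolding AM by (simp add: inner_diagonalised_axis[OF U])
  have "of_real ((norm (det M))\<^sup>2) = det (conj_transpose M ** M)"
    by (simp only: complex_norm_square det_mul det_conj_transpose mult.commute)
  also have "\<dots> = of_real (\<Prod>i\<in>UNIV. c $ i)"
    unfolding A by (rule det_diagonalised[OF U])
  finally show "(norm (det M))\<^sup>2 = (\<Prod>i\<in>UNIV. c $ i)"
    by (simp only: of_real_eq_iff)
  have "(\<Sum>i\<in>UNIV. c $ i) = (norm (M ** U))\<^sup>2"
    unfolding norm_matrix_sq by (simp only: c matrix_vector_mul_assoc)
  also have "\<dots> = (\<Sum>i\<in>UNIV. (norm (M *v axis i 1))\<^sup>2)"
    by (simp add: norm_matrix_unitary(2)[OF U] norm_matrix_sq)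
  finally show "(\<Sum>i\<in>UNIV. (norm (M *v axis i 1))\<^sup>2) = (\<Sum>i\<in>UNIV. c $ i)" ..
qed

lemma norm_det_le:
  fixes M :: "complex ^ 'd ^ 'd"
  assumes le: "\<And>x. norm (M *v x) \<le> K * norm x" and K: "0 \<le> K"
  shows "norm (det M) \<le> K ^ CARD('d)"
proof -
  obtain U c where sys: "singular_system M U c"
    using singular_system_exists by blast
  then have U: "unitary U" "\<And>i. 0 \<le> c $ i"
    by (auto simp: singular_system_def)
  have "c $ i \<le> K\<^sup>2" for i
    using le[of "U *v axis i 1"] U(1) by (simp add: singular_system_value[OF sys] norm_unitary power_mono)
  then have "(\<Prod>i\<in>UNIV. c $ i) \<le> (\<Prod>i\<in>(UNIV :: 'd set). K\<^sup>2)"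
    using U by (intro prod_mono) auto
  also have "\<dots> = (K ^ CARD('d))\<^sup>2"
    by (simp add: power2_eq_square power_mult_distrib)
  finally show ?thesis
    using K by (intro power2_le_imp_le[of "norm (det M)"]) (simp_all add: singular_system_det[OF sys])
qed

text \<open>No singular value is below \<open>1/K\<close>, so the largest one is at most \<open>|det M|\<close> divided by the product
\<open>K\<^bsup>1-d\<^esup>\<close> of \<open>d - 1\<close> such lower bounds.\<close>

lemma norm_le_of_norm_det_le:
  fixes M :: "complex ^ 'd ^ 'd"
  assumes ge: "\<And>x. norm x \<le> K * norm (M *v x)" and K: "0 < K" and det_le: "norm (det M) \<le> D"
  shows "norm (M *v x) \<le> D * K ^ (CARD('d) - 1) * norm x"
proof -
  let ?n = "CARD('d) - 1"
  obtain U c where sys: "singular_system M U c"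
    using singular_system_exists by blast
  then have U: "unitary U" "\<And>i. 0 \<le> c $ i"
    by (auto simp: singular_system_def)
  have D: "0 \<le> D" using det_le norm_ge_zero order_trans by blast
  have one: "1 \<le> K\<^sup>2 * c $ i" for i
    using ge[of "U *v axis i 1"] U(1) K power_mono[of 1 "K * norm (M *v (U *v axis i 1))" 2]
    by (simp add: singular_system_value[OF sys] norm_unitary power_mult_distrib)
  have c_le: "c $ k \<le> (D * K ^ ?n)\<^sup>2" for k
  proof -
    have "1 \<le> (\<Prod>i\<in>UNIV - {k}. K\<^sup>2 * c $ i)"
      using one by (intro prod_ge_1) auto
    then have "c $ k \<le> c $ k * (\<Prod>i\<in>UNIV - {k}. K\<^sup>2 * c $ i)"
      using U(2)[of k] by (simp add: mult_left_le mult_le_cancel_left1)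
    also have "\<dots> = (K\<^sup>2) ^ ?n * (\<Prod>i\<in>UNIV. c $ i)"
      by (subst prod.remove[of UNIV k]) (auto simp: prod.distrib card_Diff_singleton)
    also have "\<dots> \<le> (K\<^sup>2) ^ ?n * D\<^sup>2"
      using det_le by (intro mult_left_mono) (auto simp flip: singular_system_det[OF sys] intro: power_mono)
    also have "\<dots> = (D * K ^ ?n)\<^sup>2"
      by (simp add: power2_eq_square power_mult_distrib)
    finally show ?thesis .
  qed
  have "(norm (M *v x))\<^sup>2 \<le> (\<Sum>i\<in>UNIV. (D * K ^ ?n)\<^sup>2 * (norm ((conj_transpose U *v x) $ i))\<^sup>2)"
    unfolding singular_system_norm[OF sys] by (intro sum_mono mult_right_mono c_le) auto
  also have "\<dots> = (D * K ^ ?n * norm x)\<^sup>2"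
    using U(1) by (simp add: power_mult_distrib norm_unitary unitary_conj_transpose
        flip: norm_vec_sq sum_distrib_left)
  finally show ?thesis
    by (rule power2_le_imp_le) (use D K in simp)
qed

text \<open>Summing \<open>ln c \<le> c - 1\<close> over the squared singular values, whose sum is the squared Frobenius norm.
The bound is linear in the squared norms and can therefore be averaged.\<close>

lemma ln_norm_det_le:
  fixes M :: "complex ^ 'd ^ 'd"
  assumes "det M \<noteq> 0"
  shows "2 * ln (norm (det M)) \<le> (\<Sum>i\<in>UNIV. (norm (M *v axis i 1))\<^sup>2) - real CARD('d)"
proof -
  obtain U c where sys: "singular_system M U c"
    using singular_system_exists by blast
  then have U: "unitary U" "\<And>i. 0 \<le> c $ i"
    by (auto simp: singular_system_def)
  have "(\<Prod>i\<in>UNIV. c $ i) \<noteq> 0"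
    using singular_system_det[OF sys] assms by (metis norm_eq_zero power_not_zero)
  then have pos: "0 < c $ i" for i
    using U(2)[of i] by (auto simp: less_le)
  have "2 * ln (norm (det M)) = ln ((norm (det M))\<^sup>2)"
    using assms by (simp add: ln_realpow)
  also have "\<dots> = (\<Sum>i\<in>UNIV. ln (c $ i))"
    unfolding singular_system_det[OF sys] by (intro ln_prod) (simp_all add: less_imp_neq[OF pos, THEN not_sym])
  also have "\<dots> \<le> (\<Sum>i\<in>UNIV. c $ i - 1)"
    using pos by (intro sum_mono ln_le_minus_one)
  finally show ?thesis
    by (simp add: singular_system_trace[OF sys] sum_subtractf)
qed

lemma det_nonzero_inverse:
  fixes S :: "complex ^ 'd ^ 'd"
  shows "det S \<noteq> 0 \<Longrightarrow> \<exists>T. S ** T = mat 1 \<and> T ** S = mat 1"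
  using invertible_det_nz[of S] by (auto simp: invertible_def)

lemma norm_det_mono:
  fixes R S :: "complex ^ 'd ^ 'd"
  assumes S: "det S \<noteq> 0" and le: "\<And>x. norm (R *v x) \<le> K * norm (S *v x)" and K: "0 \<le> K"
  shows "norm (det R) \<le> K ^ CARD('d) * norm (det S)"
proof -
  obtain T where T: "S ** T = mat 1" "T ** S = mat 1"
    using det_nonzero_inverse[OF S] by blast
  have "norm (det (R ** T)) \<le> K ^ CARD('d)"
    using le[of "T *v _"] K by (intro norm_det_le) (simp_all add: matrix_vector_mul_assoc T)
  moreover have "R = R ** T ** S"
    by (simp add: T flip: matrix_mul_assoc)
  then have "norm (det R) = norm (det (R ** T)) * norm (det S)"
    by (metis det_mul norm_mult)
  ultimately show ?thesis
    by (simp add: mult_right_mono)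
qed

lemma norm_le_of_det_le:
  fixes R S :: "complex ^ 'd ^ 'd"
  assumes S: "det S \<noteq> 0" and le: "\<And>x. norm (S *v x) \<le> K * norm (R *v x)" and K: "0 < K"
    and det_le: "norm (det R) \<le> D * norm (det S)"
  shows "norm (R *v x) \<le> D * K ^ (CARD('d) - 1) * norm (S *v x)"
proof -
  obtain T where T: "S ** T = mat 1" "T ** S = mat 1"
    using det_nonzero_inverse[OF S] by blast
  have "norm (det T) * norm (det S) = 1"
    using T(2) by (metis det_I det_mul norm_mult norm_one)
  then have "norm (det T) = 1 / norm (det S)"
    using S by (simp add: field_simps)
  then have "norm (det (R ** T)) \<le> D"
    using det_le S by (simp add: det_mul norm_mult divide_le_eq)
  moreover have "norm y \<le> K * norm ((R ** T) *v y)" for y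
    using le[of "T *v y"] T by (simp add: matrix_vector_mul_assoc)
  ultimately have "norm ((R ** T) *v (S *v x)) \<le> D * K ^ (CARD('d) - 1) * norm (S *v x)"
    using K by (intro norm_le_of_norm_det_le)
  then show ?thesis
    by (simp add: T matrix_vector_mul_assoc flip: matrix_mul_assoc)
qed

lemma pos_def_of_injective:
  assumes psd: "pos_semidef A" and inj: "\<And>x. x \<noteq> 0 \<Longrightarrow> A *v x \<noteq> 0"
  shows "pos_def A"
proof -
  obtain U c where U: "unitary U" "\<And>i. 0 \<le> c $ i" "A = U ** diag_mat c ** conj_transpose U"
    using pos_semidef_diagonalisation[OF psd] by blast
  have c: "0 < c $ i" for i
  proof -
    have "norm (U *v axis i 1) = 1"
      using U by (simp add: norm_unitary)
    then have "A *v (U *v axis i 1) \<noteq> 0"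
      using inj by (metis norm_zero zero_neq_one)
    moreover have "A *v (U *v axis i 1) = c $ i *\<^sub>R (U *v axis i 1)"
      using U(1) unfolding U(3)
      by (simp add: unitary_cancel diag_mat_mult_axis matrix_vector_mult_of_real flip: matrix_vector_mul_assoc)
    ultimately show ?thesis using U(2)[of i] by (auto simp: less_le)
  qed
  have "0 < (A *v x) \<bullet> x" if "x \<noteq> 0" for x
  proof -
    have "conj_transpose U *v x \<noteq> 0"
      using that U(1) by (metis matrix_vector_mult_0_right unitary_cancel(1))
    then obtain i where "(conj_transpose U *v x) $ i \<noteq> 0"
      by (auto simp: vec_eq_iff)
    then show ?thesis
      unfolding U(3) inner_diagonalised using c by (intro sum_pos2[of _ i]) (auto simp: less_imp_le)
  qed
  then show ?thesis
    using psd by (simp add: pos_def_def pos_semidef_def flip: inner_eq_Re_cinner)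
qed

section \<open>John's theorem for complex norms\<close>

text \<open>The planar core of John's theorem. If a convex set contains the unit disc and the points \<open>(\<plusminus>t, 0)\<close>,
it contains the ellipse with half-axes \<open>a\<close> and \<open>b\<close> whose boundary touches the tangents from
\<open>(t, 0)\<close> to the disc, which is the equation for \<open>b\<close>. In terms of the norm: the vector
\<open>(a\<alpha>, b\<beta>)\<close> is split into a multiple of \<open>(t, 0)\<close> and the remainder \<open>(\<zeta>, b\<beta>)\<close>, which is measured by
the Euclidean norm.\<close>

lemma stretch_inequality:
  fixes t \<alpha> \<beta> a b :: real
  assumes t: "1 < t" and a: "1 \<le> a" and b: "0 \<le> b" "b\<^sup>2 = (t\<^sup>2 - a\<^sup>2) / (t\<^sup>2 - 1)"
    and \<alpha>: "0 \<le> \<alpha>" and \<beta>: "0 \<le> \<beta>"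
  obtains \<zeta> where "0 \<le> \<zeta>" "\<zeta> \<le> a * \<alpha>"
    "(a * \<alpha> - \<zeta>) / t + sqrt (\<zeta>\<^sup>2 + (b * \<beta>)\<^sup>2) \<le> sqrt (\<alpha>\<^sup>2 + \<beta>\<^sup>2)"
proof -
  define s where "s = sqrt (t\<^sup>2 - 1)"
  have "1 < t\<^sup>2" using t by (simp add: power2_eq_square) (metis less_1_mult)
  then have s: "0 < s" "s\<^sup>2 = t\<^sup>2 - 1" by (auto simp: s_def)
  have bs: "(b * s)\<^sup>2 = t\<^sup>2 - a\<^sup>2"
    using \<open>1 < t\<^sup>2\<close> by (simp add: power_mult_distrib b(2) s(2))
  show ?thesis
  proof (cases "b * \<beta> \<le> a * \<alpha> * s")
    case True
    \<comment> \<open>the remainder points at the point where the tangent touches the disc\<close>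
    define \<zeta> where "\<zeta> = b * \<beta> / s"
    have "\<zeta>\<^sup>2 + (b * \<beta>)\<^sup>2 = (b * \<beta>)\<^sup>2 * (1 + s\<^sup>2) / s\<^sup>2"
      using s(1) by (simp add: \<zeta>_def field_simps)
    also have "\<dots> = (b * \<beta> * t / s)\<^sup>2"
      by (simp add: s power_mult_distrib power_divide)
    finally have sq: "sqrt (\<zeta>\<^sup>2 + (b * \<beta>)\<^sup>2) = b * \<beta> * t / s"
      using b \<beta> t s by (simp add: real_sqrt_abs)
    have "b * \<beta> * t / s - \<zeta> / t = b * \<beta> * (t\<^sup>2 - 1) / (s * t)"
      using s(1) t by (simp add: \<zeta>_def field_simps power2_eq_square)
    also have "\<dots> = b * s * \<beta> / t"
      using s t by (simp flip: s(2)) (simp add: power2_eq_square)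
    finally have "(a * \<alpha> - \<zeta>) / t + sqrt (\<zeta>\<^sup>2 + (b * \<beta>)\<^sup>2) = (a * \<alpha> + b * s * \<beta>) / t"
      by (simp add: sq add_divide_distrib diff_divide_distrib)
    also have "\<dots> \<le> sqrt (\<alpha>\<^sup>2 + \<beta>\<^sup>2)"
    proof (rule real_le_rsqrt)
      \<comment> \<open>Lagrange's identity, the two-dimensional Cauchy-Schwarz inequality\<close>
      have "(a * \<alpha> + b * s * \<beta>)\<^sup>2 + (a * \<beta> - b * s * \<alpha>)\<^sup>2 = (a\<^sup>2 + (b * s)\<^sup>2) * (\<alpha>\<^sup>2 + \<beta>\<^sup>2)"
        by (simp add: power2_eq_square algebra_simps)
      also have "\<dots> = t\<^sup>2 * (\<alpha>\<^sup>2 + \<beta>\<^sup>2)"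
        unfolding bs by simp
      finally have "(a * \<alpha> + b * s * \<beta>)\<^sup>2 \<le> t\<^sup>2 * (\<alpha>\<^sup>2 + \<beta>\<^sup>2)"
        using zero_le_power2[of "a * \<beta> - b * s * \<alpha>"] by linarith
      then show "((a * \<alpha> + b * s * \<beta>) / t)\<^sup>2 \<le> \<alpha>\<^sup>2 + \<beta>\<^sup>2"
        using t by (simp add: power_divide divide_le_eq mult.commute)
    qed
    finally show ?thesis
      using that[of \<zeta>] True b \<beta> s by (simp add: \<zeta>_def divide_le_eq)
  next
    case False
    have b1: "1 - b\<^sup>2 = (a\<^sup>2 - 1) / s\<^sup>2"
      using s \<open>1 < t\<^sup>2\<close> by (simp add: b(2) s(2) field_simps)
    have "1 \<le> a\<^sup>2" using a by simp
    then have "b\<^sup>2 \<le> 1"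
      using b1 s(1) by (smt (verit) divide_nonneg_nonneg zero_le_power2)
    have "(\<alpha> * s)\<^sup>2 \<le> (a * \<alpha> * s)\<^sup>2"
      using a \<alpha> s by (intro power_mono) (auto simp: mult_right_mono mult_le_cancel_right1)
    also have "\<dots> \<le> (b * \<beta>)\<^sup>2"
      using False a \<alpha> s by (intro power_mono) auto
    also have "\<dots> \<le> \<beta>\<^sup>2"
      using \<open>b\<^sup>2 \<le> 1\<close> by (simp add: power_mult_distrib mult_left_le_one_le)
    finally have "\<alpha>\<^sup>2 \<le> \<beta>\<^sup>2 / s\<^sup>2"
      using s(1) by (simp add: field_simps)
    then have "(a\<^sup>2 - 1) * \<alpha>\<^sup>2 \<le> (a\<^sup>2 - 1) * (\<beta>\<^sup>2 / s\<^sup>2)"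
      using \<open>1 \<le> a\<^sup>2\<close> by (intro mult_left_mono) auto
    also have "\<dots> = (1 - b\<^sup>2) * \<beta>\<^sup>2" by (simp add: b1)
    finally have "(a * \<alpha>)\<^sup>2 + (b * \<beta>)\<^sup>2 \<le> \<alpha>\<^sup>2 + \<beta>\<^sup>2"
      by (simp add: algebra_simps power_mult_distrib)
    then show ?thesis
      using that[of "a * \<alpha>"] a \<alpha> by simp
  qed
qed

text \<open>With \<open>a\<^sup>2 = 1 + \<epsilon>\<close> the tangency condition reads \<open>b\<^sup>2 = 1 - \<epsilon>/\<tau>\<close> with \<open>\<tau> = t\<^sup>2 - 1\<close>, and
\<open>(1 + \<epsilon>) (1 - \<epsilon>/\<tau>)\<^sup>n\<close> has derivative \<open>1 - n/\<tau> > 0\<close> at \<open>\<epsilon> = 0\<close>; so a small \<open>\<epsilon>\<close> enlarges the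
volume. For \<open>n = d - 1\<close> the hypothesis is \<open>t > \<surd>d\<close>, the source of the constant in John's theorem.\<close>

lemma stretch_factors_exist:
  fixes t :: real and n :: nat
  assumes t: "1 < t" "real n < t\<^sup>2 - 1"
  obtains a b where "1 \<le> a" "0 \<le> b" "b\<^sup>2 = (t\<^sup>2 - a\<^sup>2) / (t\<^sup>2 - 1)" "1 < a * b ^ n"
proof -
  define \<tau> where "\<tau> = t\<^sup>2 - 1"
  have \<tau>: "real n < \<tau>" "0 < \<tau>" using t by (auto simp: \<tau>_def)
  \<comment> \<open>by Bernoulli's inequality any \<open>\<epsilon> \<le> \<tau>\<close> with \<open>n\<epsilon> < \<tau> - n\<close> will do\<close>
  define \<epsilon> where "\<epsilon> = (\<tau> - real n) / (real n + 1)"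
  have \<epsilon>: "0 < \<epsilon>" using \<tau> by (simp add: \<epsilon>_def)
  have \<epsilon>n: "\<epsilon> * (real n + 1) = \<tau> - real n" by (simp add: \<epsilon>_def)
  have "\<epsilon> \<le> \<tau>" using \<epsilon>n \<epsilon> by (simp add: algebra_simps) (smt (verit) mult_nonneg_nonneg of_nat_0_le_iff)
  define \<delta> where "\<delta> = \<epsilon> / \<tau>"
  have \<delta>: "0 < \<delta>" "\<delta> \<le> 1" using \<epsilon> \<tau> \<open>\<epsilon> \<le> \<tau>\<close> by (auto simp: \<delta>_def)
  define a where "a = sqrt (1 + \<epsilon>)"
  define b where "b = sqrt (1 - \<delta>)"
  have a: "1 \<le> a" "a\<^sup>2 = 1 + \<epsilon>" using \<epsilon> by (auto simp: a_def)
  have b: "0 \<le> b" "b\<^sup>2 = 1 - \<delta>" using \<delta> by (auto simp: b_def)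
  have "\<epsilon> * real n < \<tau> - real n" using \<epsilon> \<epsilon>n by (simp add: algebra_simps)
  then have "0 < \<delta> * (\<tau> - real n - \<epsilon> * real n)" using \<delta> by simp
  also have "\<dots> = (1 + \<epsilon>) * (1 - real n * \<delta>) - 1"
    using \<tau> by (simp add: \<delta>_def field_simps)
  finally have "1 < (1 + \<epsilon>) * (1 - real n * \<delta>)" by simp
  also have "\<dots> \<le> (1 + \<epsilon>) * (1 - \<delta>) ^ n"
    using Bernoulli_inequality[of "- \<delta>" n] \<delta> \<epsilon> by (intro mult_left_mono) auto
  also have "\<dots> = (a * b ^ n)\<^sup>2"
    unfolding a(2)[symmetric] b(2)[symmetric] by (simp add: power2_eq_square power_mult_distrib)
  finally have "1 < a * b ^ n"
    using a(1) b(1) by (intro power_less_imp_less_base[of 1 2]) auto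
  moreover have "b\<^sup>2 = (t\<^sup>2 - a\<^sup>2) / (t\<^sup>2 - 1)"
    using \<tau> by (simp add: a b \<delta>_def field_simps \<tau>_def)
  ultimately show ?thesis using that a b by blast
qed

locale complex_norm =
  fixes \<rho> :: "complex ^ 'd \<Rightarrow> real"
  assumes triangle: "\<rho> (x + y) \<le> \<rho> x + \<rho> y"
    and homogeneous: "\<rho> (z *s x) = norm z * \<rho> x"
    and positive: "x \<noteq> 0 \<Longrightarrow> 0 < \<rho> x"
begin

lemma zero [simp]: "\<rho> 0 = 0"
  using homogeneous[of 0 0] by simp

lemma nonneg: "0 \<le> \<rho> x"
  using positive[of x] by (cases "x = 0") auto

lemma sum_le: "finite I \<Longrightarrow> \<rho> (\<Sum>i\<in>I. f i) \<le> (\<Sum>i\<in>I. \<rho> (f i))"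
proof (induction I rule: finite_induct)
  case (insert i I)
  then show ?case using triangle[of "f i" "\<Sum>i\<in>I. f i"] by simp
qed simp

lemma upper_bound:
  obtains L where "0 < L" "\<And>x. \<rho> x \<le> L * norm x"
proof -
  define L where "L = (\<Sum>i\<in>UNIV. \<rho> (axis i 1)) + 1"
  have "\<rho> x \<le> L * norm x" for x
  proof -
    have "\<rho> x = \<rho> (\<Sum>i\<in>UNIV. x $ i *s axis i 1)"
      by (simp add: basis_expansion)
    also have "\<dots> \<le> (\<Sum>i\<in>UNIV. norm (x $ i) * \<rho> (axis i 1))"
      using sum_le[of UNIV "\<lambda>i. x $ i *s axis i 1"] by (simp add: homogeneous)
    also have "\<dots> \<le> (\<Sum>i\<in>UNIV. norm x * \<rho> (axis i 1))"
      by (intro sum_mono mult_right_mono nonneg Finite_Cartesian_Product.norm_nth_le)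
    also have "\<dots> \<le> L * norm x"
      by (simp add: L_def algebra_simps sum_distrib_left)
    finally show ?thesis .
  qed
  moreover have "0 < L" by (simp add: L_def add_nonneg_pos sum_nonneg nonneg)
  ultimately show ?thesis using that by blast
qed

lemma minus: "\<rho> (x - y) = \<rho> (y - x)"
proof -
  have "x - y = (- 1) *s (y - x)"
    by (simp add: vec_eq_iff)
  then show ?thesis
    by (simp only: homogeneous) simp
qed

lemma continuous: "continuous_on S \<rho>"
proof -
  obtain L where L: "0 < L" "\<And>x. \<rho> x \<le> L * norm x"
    using upper_bound by blast
  have "dist (\<rho> x) (\<rho> y) \<le> L * dist x y" for x y
    using triangle[of "x - y" y] triangle[of "y - x" x] minus[of x y] L(2)[of "x - y"]
    by (auto simp: dist_norm abs_le_iff)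
  then have "L-lipschitz_on S \<rho>"
    using L by (intro lipschitz_onI) auto
  then show ?thesis by (rule lipschitz_on_continuous_on)
qed

lemma scaleR: "\<rho> (r *\<^sub>R x) = \<bar>r\<bar> * \<rho> x"
proof -
  have "r *\<^sub>R x = of_real r *s x"
    by (simp add: vec_eq_iff) (simp add: scaleR_conv_of_real)
  then show ?thesis by (simp only: homogeneous norm_of_real)
qed

lemma lower_bound:
  obtains m where "0 < m" "\<And>x. m * norm x \<le> \<rho> x"
proof -
  have "axis k 1 \<in> sphere (0 :: complex ^ 'd) 1" for k
    by simp
  then have "sphere (0 :: complex ^ 'd) 1 \<noteq> {}"
    by blast
  then have "\<exists>x\<in>sphere 0 1. \<forall>y\<in>sphere 0 1. \<rho> x \<le> \<rho> y"
    by (intro continuous_attains_inf continuous) auto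
  then obtain u where u: "norm u = 1" "\<And>y. norm y = 1 \<Longrightarrow> \<rho> u \<le> \<rho> y"
    by auto
  have "\<rho> u * norm x \<le> \<rho> x" for x
  proof (cases "x = 0")
    case False
    then have "\<rho> u \<le> \<rho> (inverse (norm x) *\<^sub>R x)"
      by (intro u) simp
    then show ?thesis
      using False by (simp add: scaleR field_simps)
  qed simp
  moreover have "0 < \<rho> u"
    using u(1) by (intro positive) auto
  ultimately show ?thesis using that by blast
qed

text \<open>If \<open>T\<close> maps the Euclidean ball into the unit ball of \<open>\<rho>\<close> and \<open>Te\<^sub>k\<close> is well inside, then
\<open>T\<close> can be stretched in the direction \<open>e\<^sub>k\<close> at the price of a slight shrinking in the others.\<close>

lemma stretch_contraction:
  fixes T :: "complex ^ 'd ^ 'd"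
  assumes T: "\<And>x. \<rho> (T *v x) \<le> norm x" and k: "\<rho> (T *v axis k 1) \<le> 1 / t"
    and t: "1 < t" and a: "1 \<le> a" and b: "0 \<le> b" "b\<^sup>2 = (t\<^sup>2 - a\<^sup>2) / (t\<^sup>2 - 1)"
  shows "\<rho> ((T ** diag_mat (\<chi> i. if i = k then a else b)) *v x) \<le> norm x"
proof -
  define y where "y = diag_mat (\<chi> i. if i = k then a else b) *v x"
  have y: "y $ i = of_real (if i = k then a else b) * x $ i" for i
    by (simp add: y_def diag_mat_mult_vec)
  define \<alpha> where "\<alpha> = norm (x $ k)"
  define \<beta> where "\<beta> = sqrt (\<Sum>i\<in>UNIV - {k}. (norm (x $ i))\<^sup>2)"
  have \<beta>: "0 \<le> \<beta>" "\<beta>\<^sup>2 = (\<Sum>i\<in>UNIV - {k}. (norm (x $ i))\<^sup>2)"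
    by (auto simp: \<beta>_def sum_nonneg)
  obtain \<zeta> where \<zeta>: "0 \<le> \<zeta>" "\<zeta> \<le> a * \<alpha>"
    and le: "(a * \<alpha> - \<zeta>) / t + sqrt (\<zeta>\<^sup>2 + (b * \<beta>)\<^sup>2) \<le> sqrt (\<alpha>\<^sup>2 + \<beta>\<^sup>2)"
    using stretch_inequality[OF t a b, of \<alpha> \<beta>] \<beta> by (auto simp: \<alpha>_def)
  define \<mu> where "\<mu> = \<zeta> / (a * \<alpha>)"
  have \<mu>: "0 \<le> \<mu>" "\<mu> \<le> 1" "\<mu> * (a * \<alpha>) = \<zeta>"
    using \<zeta> a by (auto simp: \<mu>_def \<alpha>_def divide_le_eq_1)
  define z where "z = (\<chi> i. if i = k then of_real \<mu> * y $ k else y $ i)"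
  have split: "y = (of_real (1 - \<mu>) * y $ k) *s axis k 1 + z"
    by (simp add: vec_eq_iff z_def axis_def algebra_simps)
  have yk: "norm (y $ k) = a * \<alpha>"
    using a by (simp add: y \<alpha>_def norm_mult)
  have "(norm z)\<^sup>2 = \<zeta>\<^sup>2 + (\<Sum>i\<in>UNIV - {k}. (norm (y $ i))\<^sup>2)"
  proof -
    have "norm (z $ k) = \<zeta>"
      using \<mu> by (simp add: z_def norm_mult yk)
    then show ?thesis
      unfolding norm_vec_sq by (subst sum.remove[of UNIV k]) (auto simp: z_def intro!: sum.cong)
  qed
  also have "(\<Sum>i\<in>UNIV - {k}. (norm (y $ i))\<^sup>2) = (b * \<beta>)\<^sup>2"
    by (simp add: y \<beta> norm_mult power_mult_distrib sum_distrib_left)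
  finally have z: "norm z = sqrt (\<zeta>\<^sup>2 + (b * \<beta>)\<^sup>2)"
    by (metis norm_ge_zero real_sqrt_unique)
  have x: "norm x = sqrt (\<alpha>\<^sup>2 + \<beta>\<^sup>2)"
  proof -
    have "(norm x)\<^sup>2 = \<alpha>\<^sup>2 + \<beta>\<^sup>2"
      unfolding norm_vec_sq \<beta> \<alpha>_def by (subst sum.remove[of UNIV k]) auto
    then show ?thesis by (metis norm_ge_zero real_sqrt_unique)
  qed
  have "T *v y = (of_real (1 - \<mu>) * y $ k) *s (T *v axis k 1) + T *v z"
    by (subst split) (simp only: matrix_vector_right_distrib vector_scalar_commute)
  then have "\<rho> (T *v y) \<le> norm (of_real (1 - \<mu>) * y $ k) * \<rho> (T *v axis k 1) + \<rho> (T *v z)"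
    by (metis homogeneous triangle)
  also have "norm (of_real (1 - \<mu>) * y $ k) = a * \<alpha> - \<zeta>"
  proof -
    have "norm (of_real (1 - \<mu>) * y $ k) = (1 - \<mu>) * (a * \<alpha>)"
      using \<mu> by (simp only: norm_mult norm_of_real yk)
    then show ?thesis using \<mu>(3) by (simp add: algebra_simps)
  qed
  also have "(a * \<alpha> - \<zeta>) * \<rho> (T *v axis k 1) + \<rho> (T *v z) \<le> (a * \<alpha> - \<zeta>) * (1 / t) + norm z"
    using \<zeta> k T by (intro add_mono mult_left_mono) auto
  also have "\<dots> \<le> norm x"
    using le by (simp add: x z)
  finally show ?thesis
    by (simp add: y_def matrix_vector_mul_assoc)
qed

text \<open>The ellipsoids in the unit ball of \<open>\<rho>\<close> are the images of the Euclidean ball under the contractions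
\<open>T\<close>. Since \<open>\<rho>\<close> is comparable with the Euclidean norm, these \<open>T\<close> form a compact set, on which the
volume \<open>|det T|\<close> attains its maximum.\<close>

lemma extremal_contraction_exists:
  obtains T :: "complex ^ 'd ^ 'd" where "\<And>x. \<rho> (T *v x) \<le> norm x" "det T \<noteq> 0"
    "\<And>T'. (\<And>x. \<rho> (T' *v x) \<le> norm x) \<Longrightarrow> norm (det T') \<le> norm (det T)"
proof -
  define F where "F = {T :: complex ^ 'd ^ 'd. \<forall>x. \<rho> (T *v x) \<le> norm x}"
  obtain L where L: "0 < L" "\<And>x. \<rho> x \<le> L * norm x" using upper_bound by blast
  obtain m where m: "0 < m" "\<And>x. m * norm x \<le> \<rho> x" using lower_bound by blast
  have "norm T \<le> sqrt (real CARD('d)) / m" if "T \<in> F" for T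
  proof -
    have "norm (T *v axis i 1) \<le> 1 / m" for i
      using that m(2)[of "T *v axis i 1"] m(1) unfolding F_def
      by (simp add: field_simps) (metis norm_axis_one order_trans)
    then have "(norm T)\<^sup>2 \<le> (\<Sum>i\<in>(UNIV :: 'd set). (1 / m)\<^sup>2)"
      unfolding norm_matrix_sq by (intro sum_mono power_mono) auto
    also have "\<dots> = (sqrt (real CARD('d)) / m)\<^sup>2"
      by (simp add: power_divide)
    finally show ?thesis
      by (rule power2_le_imp_le) (use m in simp)
  qed
  then have "bounded F" by (auto simp: bounded_iff)
  moreover have "closed F"
  proof -
    have "continuous_on UNIV (\<lambda>T :: complex ^ 'd ^ 'd. T *v x)" for x
      unfolding matrix_vector_mult_def by (intro continuous_intros)
    then have "continuous_on UNIV (\<lambda>T :: complex ^ 'd ^ 'd. \<rho> (T *v x))" for x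
      by (rule continuous_on_compose2[OF continuous[of UNIV]]) auto
    then show ?thesis
      unfolding F_def by (intro closed_Collect_all closed_Collect_le continuous_intros)
  qed
  ultimately have "compact F" by (simp add: compact_eq_bounded_closed)
  define E :: "complex ^ 'd ^ 'd" where "E = diag_mat (\<chi> i. 1 / L)"
  have E: "E *v x = (1 / L) *\<^sub>R x" for x
    by (simp add: E_def diag_mat_mult_vec vec_eq_iff) (simp add: scaleR_conv_of_real)
  have "E \<in> F"
    using L by (simp add: F_def E scaleR field_simps)
  have "continuous_on F (\<lambda>T. norm (det T))"
    unfolding det_def by (intro continuous_intros)
  then have "\<exists>T\<in>F. \<forall>T'\<in>F. norm (det T') \<le> norm (det T)"
    using \<open>compact F\<close> \<open>E \<in> F\<close> by (intro continuous_attains_sup) auto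
  then obtain T where T: "T \<in> F" "\<And>T'. T' \<in> F \<Longrightarrow> norm (det T') \<le> norm (det T)" by blast
  have "det E \<noteq> 0"
    using L by (simp add: E_def det_diag_mat)
  then have "det T \<noteq> 0"
    using T(2)[OF \<open>E \<in> F\<close>] by auto
  then show ?thesis
    using T that by (auto simp: F_def)
qed

text \<open>Let \<open>T\<close> map the ball onto an ellipsoid of maximal volume and \<open>S = T\<^bsup>-1\<^esup>\<close>. If \<open>|Sx| > \<surd>d \<rho>(x)\<close> for some
\<open>x\<close>, stretching the ellipsoid in the direction of \<open>x\<close> would increase its volume. The
positive definite \<open>R\<close> is the factor \<open>(S\<^sup>*S)\<^bsup>1/2\<^esup>\<close> of the polar decomposition of \<open>S\<close>.\<close>

theorem john_ellipsoid:
  "\<exists>R. pos_def R \<and> (\<forall>x. \<rho> x \<le> norm (R *v x) \<and> norm (R *v x) \<le> sqrt (real CARD('d)) * \<rho> x)"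
proof -
  obtain T :: "complex ^ 'd ^ 'd" where T: "\<And>x. \<rho> (T *v x) \<le> norm x" "det T \<noteq> 0"
    and max: "\<And>T'. (\<And>x. \<rho> (T' *v x) \<le> norm x) \<Longrightarrow> norm (det T') \<le> norm (det T)"
    using extremal_contraction_exists by metis
  obtain S where S: "T ** S = mat 1" "S ** T = mat 1"
    using det_nonzero_inverse[OF T(2)] by blast
  have TS: "T *v (S *v x) = x" for x
    by (simp add: matrix_vector_mul_assoc S)
  have lower: "\<rho> x \<le> norm (S *v x)" for x
    using T(1)[of "S *v x"] by (simp add: TS)
  have upper: "norm (S *v x) \<le> sqrt (real CARD('d)) * \<rho> x" for x
  proof (rule ccontr)
    assume "\<not> ?thesis"
    then have big: "sqrt (real CARD('d)) * \<rho> x < norm (S *v x)" by simp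
    then have "x \<noteq> 0" by auto
    then have \<rho>x: "0 < \<rho> x" by (rule positive)
    define t where "t = norm (S *v x) / \<rho> x"
    have td: "sqrt (real CARD('d)) < t"
      using big \<rho>x by (simp add: t_def field_simps)
    have d1: "1 \<le> real CARD('d)"
      by (simp add: Suc_leI)
    then have t: "1 < t"
      using td real_sqrt_ge_one[OF d1] by linarith
    have "real CARD('d) < t\<^sup>2"
      using power_strict_mono[OF td, of 2] by simp
    then have tn: "real (CARD('d) - 1) < t\<^sup>2 - 1"
      using d1 by (simp add: of_nat_diff)
    define u where "u = (1 / norm (S *v x)) *\<^sub>R (S *v x)"
    have Sx: "0 < norm (S *v x)" using \<rho>x lower[of x] by linarith
    then have u: "norm u = 1" by (simp add: u_def)
    fix k :: 'd
    obtain H z where H: "unitary H" "norm z = 1" "H *v axis k 1 = z *s u"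
      using householder_exists[OF u, of "{}" k] by auto
    have TH: "\<rho> ((T ** H) *v y) \<le> norm y" for y
      using T(1)[of "H *v y"] H(1) by (simp add: norm_unitary matrix_vector_mul_assoc)
    have "(T ** H) *v axis k 1 = z *s ((1 / norm (S *v x)) *\<^sub>R x)"
      by (simp add: H(3) vector_scalar_commute u_def matrix_vector_mult_of_real TS flip: matrix_vector_mul_assoc)
    then have THk: "\<rho> ((T ** H) *v axis k 1) \<le> 1 / t"
      using \<rho>x by (simp add: homogeneous H(2) scaleR t_def)
    obtain a b where ab: "1 \<le> a" "0 \<le> b" "b\<^sup>2 = (t\<^sup>2 - a\<^sup>2) / (t\<^sup>2 - 1)" "1 < a * b ^ (CARD('d) - 1)"
      using stretch_factors_exist[OF t tn] by blast
    define D :: "complex ^ 'd ^ 'd" where "D = diag_mat (\<chi> i. if i = k then a else b)"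
    \<comment> \<open>\<open>H\<close> rotates the direction of \<open>Sx\<close> to a coordinate axis, where the stretching is diagonal\<close>
    have "norm (det (T ** H ** D)) \<le> norm (det T)"
      using stretch_contraction[OF TH THk t ab(1-3)] unfolding D_def by (rule max)
    moreover have "norm (det (T ** H ** D)) = norm (det T) * norm (det D)"
      by (simp add: det_mul norm_mult norm_det_unitary H(1))
    moreover have "norm (det D) = a * b ^ (CARD('d) - 1)"
    proof -
      have "(\<Prod>i\<in>UNIV. if i = k then a else b) = a * (\<Prod>i\<in>UNIV - {k}. if i = k then a else b)"
        by (subst prod.remove[of UNIV k]) auto
      also have "(\<Prod>i\<in>UNIV - {k}. if i = k then a else b) = (\<Prod>i\<in>UNIV - {k}. b)"
        by (intro prod.cong) auto
      also have "\<dots> = b ^ (CARD('d) - 1)"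
        by (simp add: card_Diff_singleton)
      finally show ?thesis
        using ab by (simp add: D_def det_diag_mat norm_mult norm_power)
    qed
    ultimately show False
      using T(2) ab(4) by (simp add: mult_le_cancel_left1)
  qed
  define A where "A = conj_transpose S ** S"
  have A: "Re (cinner (A *v x) x) = (norm (S *v x))\<^sup>2" for x
    by (simp add: A_def norm_eq_inner_adjoint inner_commute flip: inner_eq_Re_cinner)
  have "pos_semidef A"
    by (simp add: pos_semidef_def A) (simp add: A_def hermitian_def conj_transpose_mult)
  define R where "R = mat_powr A (1 / 2)"
  have R: "norm (R *v x) = norm (S *v x)" for x
    using norm_mat_powr_half[OF \<open>pos_semidef A\<close>, of x] by (simp add: R_def A)
  have "pos_def R"
  proof (rule pos_def_of_injective)
    show "pos_semidef R"
      unfolding R_def by (rule pos_semidef_mat_powr[OF \<open>pos_semidef A\<close>])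
    show "R *v x \<noteq> 0" if "x \<noteq> 0" for x
      using positive[OF that] lower[of x] R[of x] by auto
  qed
  then show ?thesis
    using lower upper R by auto
qed

end

section \<open>Averages over cubes\<close>

lemma cube_facts:
  fixes Q :: "(real ^ 'n) set"
  assumes "cube Q"
  shows "Q \<in> sets lebesgue" "compact Q" "0 < measure lebesgue Q" "emeasure lebesgue Q < \<infinity>"
proof -
  obtain a :: "real ^ 'n" and l where l: "0 < l" and Q: "Q = cbox a (a + (\<chi> i. l))"
    using assms by (auto simp: cube_def)
  show "compact Q" "Q \<in> sets lebesgue" "emeasure lebesgue Q < \<infinity>"
    by (auto simp: Q emeasure_lborel_cbox_eq)
  show "0 < measure lebesgue Q"
    using l by (simp add: Q content_cbox_cart interval_ne_empty_cart prod_pos)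
qed

lemma powr_ge_tangent:
  fixes t p :: real
  assumes t: "0 \<le> t" and p: "1 \<le> p"
  shows "1 + p * (t - 1) \<le> t powr p"
proof (cases "t = 0")
  case False
  have "((\<lambda>x. x powr p) has_real_derivative p) (at 1 within {0<..})"
    by (auto intro!: derivative_eq_intros)
  then have "t powr p - 1 powr p \<ge> p * (t - 1)"
    using False t p by (intro convex_on_imp_above_tangent[OF powr_convex]) (auto simp: interior_open)
  then show ?thesis by simp
qed (use p in auto)

text \<open>The tangent of \<open>u \<mapsto> u\<^sup>p\<close> at \<open>m\<close>. Every convexity argument below averages this bound with \<open>m\<close> the
mean value; it includes \<open>u = 0\<close>, the value of a quadratic form at a degenerate point.\<close>

lemma powr_ge_scaled_tangent:
  fixes m u p :: real
  assumes "0 < m" "0 \<le> u" "1 \<le> p"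
  shows "m powr p * (1 + p * (u / m - 1)) \<le> u powr p"
proof -
  have "m powr p * (1 + p * (u / m - 1)) \<le> m powr p * (u / m) powr p"
    using assms by (intro mult_left_mono powr_ge_tangent) auto
  also have "\<dots> = u powr p"
    using assms by (simp flip: powr_mult)
  finally show ?thesis .
qed

lemma powr_convex_combination:
  fixes u v s p :: real
  assumes u: "0 \<le> u" and v: "0 \<le> v" and s: "0 \<le> s" "s \<le> 1" and p: "1 \<le> p"
  shows "(s * u + (1 - s) * v) powr p \<le> s * u powr p + (1 - s) * v powr p"
proof -
  define m where "m = s * u + (1 - s) * v"
  have "0 \<le> m" using assms by (simp add: m_def)
  show ?thesis
  proof (cases "m = 0")
    case True
    then show ?thesis using s by (simp flip: m_def)
  next
    case False
    then have m: "0 < m" using \<open>0 \<le> m\<close> by simp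
    have "m powr p = s * (m powr p * (1 + p * (u / m - 1))) + (1 - s) * (m powr p * (1 + p * (v / m - 1)))"
    proof -
      have 1: "s * (u / m) + (1 - s) * (v / m) = 1"
        using m by (simp flip: add_divide_distrib m_def)
      have "s * (m powr p * (1 + p * (u / m - 1))) + (1 - s) * (m powr p * (1 + p * (v / m - 1)))
          = m powr p * (1 + p * ((s * (u / m) + (1 - s) * (v / m)) - 1))"
        by (simp only: algebra_simps)
      then show ?thesis
        by (simp only: 1) simp
    qed
    also have "\<dots> \<le> s * u powr p + (1 - s) * v powr p"
      using m assms by (intro add_mono mult_left_mono powr_ge_scaled_tangent) auto
    finally show ?thesis by (simp add: m_def)
  qed
qed

context
  fixes Q :: "(real ^ 'n) set"
  assumes Q: "cube Q"
begin

lemma integrable_cube_const: "set_integrable lebesgue Q (\<lambda>x. c :: real)"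
  using cube_facts[OF Q] by (simp add: set_integrable_def)

lemma avg_const: "avg Q (\<lambda>x. c :: real) = c"
  using cube_facts[OF Q] by (simp add: avg_def set_lebesgue_integral_def)

lemma avg_add:
  fixes f g :: "real ^ 'n \<Rightarrow> real"
  assumes "set_integrable lebesgue Q f" "set_integrable lebesgue Q g"
  shows "avg Q (\<lambda>x. f x + g x) = avg Q f + avg Q g"
  using assms by (simp add: avg_def set_integral_add algebra_simps)

lemma avg_cmult: "avg Q (\<lambda>x. c * f x) = c * avg Q f" for f :: "real ^ 'n \<Rightarrow> real"
  by (simp add: avg_def)

lemma avg_sum:
  fixes f :: "'a \<Rightarrow> real ^ 'n \<Rightarrow> real"
  assumes "finite I" "\<And>i. i \<in> I \<Longrightarrow> set_integrable lebesgue Q (f i)"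
  shows "set_integrable lebesgue Q (\<lambda>x. \<Sum>i\<in>I. f i x)"
    and "avg Q (\<lambda>x. \<Sum>i\<in>I. f i x) = (\<Sum>i\<in>I. avg Q (f i))"
  using assms
proof (induction I rule: finite_induct)
  case empty
  { case 1 show ?case using integrable_cube_const by simp }
  { case 2 show ?case using avg_const by simp }
next
  case (insert i I)
  { case 1 then show ?case using insert by (simp add: set_integral_add) }
  { case 2 then show ?case using insert by (simp add: avg_add) }
qed

lemma avg_mono_AE:
  fixes f g :: "real ^ 'n \<Rightarrow> real"
  assumes "set_integrable lebesgue Q f" "set_integrable lebesgue Q g"
    and "AE x in lebesgue. x \<in> Q \<longrightarrow> f x \<le> g x"
  shows "avg Q f \<le> avg Q g"
proof -
  have "(LINT x:Q|lebesgue. f x) \<le> (LINT x:Q|lebesgue. g x)"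
    using assms unfolding set_lebesgue_integral_def set_integrable_def
    by (intro integral_mono_AE) (auto elim!: eventually_mono simp: indicator_def)
  then show ?thesis
    by (simp add: avg_def divide_right_mono)
qed

lemma avg_mono:
  fixes f g :: "real ^ 'n \<Rightarrow> real"
  assumes "set_integrable lebesgue Q f" "set_integrable lebesgue Q g" "\<And>x. f x \<le> g x"
  shows "avg Q f \<le> avg Q g"
  using assms by (intro avg_mono_AE) auto

lemma avg_nonneg: "(\<And>x. 0 \<le> f x) \<Longrightarrow> 0 \<le> avg Q f" for f :: "real ^ 'n \<Rightarrow> real"
  by (simp add: avg_def set_lebesgue_integral_def)

lemma avg_pos:
  fixes f :: "real ^ 'n \<Rightarrow> real"
  assumes f: "set_integrable lebesgue Q f" "\<And>x. 0 \<le> f x" and pos: "AE x in lebesgue. 0 < f x"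
  shows "0 < avg Q f"
proof (rule ccontr)
  assume "\<not> 0 < avg Q f"
  then have "avg Q f = 0" using avg_nonneg f(2) by (metis less_eq_real_def)
  then have "(\<integral>x. indicator Q x *\<^sub>R f x \<partial>lebesgue) = 0"
    using cube_facts(3)[OF Q] by (simp add: avg_def set_lebesgue_integral_def)
  then have "AE x in lebesgue. indicator Q x *\<^sub>R f x = 0"
    using f by (subst (asm) integral_nonneg_eq_0_iff_AE) (auto simp: set_integrable_def)
  then have "AE x in lebesgue. x \<notin> Q"
    using pos by eventually_elim (auto simp: indicator_def split: if_splits)
  then have "emeasure lebesgue Q = 0"
    using cube_facts(1)[OF Q] by (subst (asm) AE_iff_measurable[of Q]) auto
  then show False
    using cube_facts(3)[OF Q] by (simp add: measure_def)
qed

lemma avg_powr_jensen: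
  fixes f :: "real ^ 'n \<Rightarrow> real"
  assumes f: "set_integrable lebesgue Q f" "set_integrable lebesgue Q (\<lambda>x. f x powr p)"
    and nonneg: "\<And>x. 0 \<le> f x" and p: "1 \<le> p"
  shows "avg Q f powr p \<le> avg Q (\<lambda>x. f x powr p)"
proof (cases "avg Q f = 0")
  case True
  then show ?thesis using avg_nonneg by simp
next
  case False
  define m where "m = avg Q f"
  have m: "0 < m" using False avg_nonneg nonneg by (metis m_def less_eq_real_def)
  define c where "c = m powr p"
  have int: "set_integrable lebesgue Q (\<lambda>x. c * (1 - p) + (c * p / m) * f x)"
    using f integrable_cube_const by (intro set_integral_add) auto
  have "c = c * (1 - p) + (c * p / m) * m"
    using m by (simp add: algebra_simps)
  also have "\<dots> = avg Q (\<lambda>x. c * (1 - p) + (c * p / m) * f x)"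
    using f integrable_cube_const
    by (subst avg_add) (auto simp only: avg_const avg_cmult m_def intro!: set_integrable_mult_right)
  also have "\<dots> \<le> avg Q (\<lambda>x. f x powr p)"
  proof (rule avg_mono[OF int f(2)])
    fix x
    have "c * (1 - p) + (c * p / m) * f x = m powr p * (1 + p * (f x / m - 1))"
      by (simp add: c_def algebra_simps)
    also have "\<dots> \<le> f x powr p"
      using m nonneg p by (intro powr_ge_scaled_tangent) auto
    finally show "c * (1 - p) + (c * p / m) * f x \<le> f x powr p" .
  qed
  finally show ?thesis by (simp add: c_def m_def)
qed

end

section \<open>The norms given by a weight\<close>

definition qform :: "(real ^ 'n \<Rightarrow> complex ^ 'd ^ 'd) \<Rightarrow> complex ^ 'd \<Rightarrow> real ^ 'n \<Rightarrow> real"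
  where "qform V e x = Re (cinner (V x *v e) e)"

text \<open>Because \<open>\<langle>Ve, e\<rangle> = |V\<^bsup>1/2\<^esup>e|\<^sup>2\<close>, this is the \<open>L\<^bsup>2p\<^esup>\<close> average of \<open>|V\<^bsup>1/2\<^esup>e|\<close>, the norm in the definition of
the reducing matrix of \<open>V\<^sup>p\<close> for the exponent \<open>2p\<close>.\<close>

definition weight_norm ::
    "(real ^ 'n \<Rightarrow> complex ^ 'd ^ 'd) \<Rightarrow> real \<Rightarrow> (real ^ 'n) set \<Rightarrow> complex ^ 'd \<Rightarrow> real"
  where "weight_norm V p Q e = avg Q (\<lambda>x. qform V e x powr p) powr (1 / (2 * p))"

lemma norm_le_op_norm: "norm (A *v x) \<le> op_norm A * norm x" for A :: "complex ^ 'd ^ 'd"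
  by (rule onorm[OF matrix_vector_mul_bounded_linear])

lemma op_norm_nonneg: "0 \<le> op_norm A" for A :: "complex ^ 'd ^ 'd"
  by (rule onorm_pos_le[OF matrix_vector_mul_bounded_linear])

lemma norm_matrix_le_op_norm: "norm A \<le> sqrt (real CARD('d)) * op_norm A" for A :: "complex ^ 'd ^ 'd"
proof (rule power2_le_imp_le)
  have "(norm A)\<^sup>2 \<le> (\<Sum>i\<in>(UNIV :: 'd set). (op_norm A)\<^sup>2)"
    unfolding norm_matrix_sq using norm_le_op_norm[of A "axis _ 1"]
    by (intro sum_mono power_mono) auto
  then show "(norm A)\<^sup>2 \<le> (sqrt (real CARD('d)) * op_norm A)\<^sup>2"
    by (simp add: power_mult_distrib)
qed (simp add: op_norm_nonneg)

lemma qform_nonneg: "matrix_weight V \<Longrightarrow> 0 \<le> qform V e x"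
  by (simp add: matrix_weight_def pos_semidef_def qform_def)

lemma qform_le: "qform V e x \<le> op_norm (V x) * (norm e)\<^sup>2"
proof -
  have "qform V e x \<le> norm (V x *v e) * norm e"
    unfolding qform_def inner_eq_Re_cinner[symmetric] by (rule norm_cauchy_schwarz)
  also have "\<dots> \<le> op_norm (V x) * norm e * norm e"
    by (intro mult_right_mono norm_le_op_norm) auto
  finally show ?thesis by (simp add: power2_eq_square)
qed

lemma qform_half: "matrix_weight V \<Longrightarrow> (norm (mat_powr (V x) (1 / 2) *v e))\<^sup>2 = qform V e x"
  by (simp add: matrix_weight_def qform_def norm_mat_powr_half)

lemma qform_scale: "qform V (z *s e) x = (norm z)\<^sup>2 * qform V e x"
proof -
  have "cinner (z *s v) (z *s e) = of_real ((norm z)\<^sup>2) * cinner v e" for v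
    unfolding complex_norm_square by (simp add: cinner_def sum_distrib_left mult_ac)
  then show ?thesis
    by (simp add: qform_def vector_scalar_commute)
qed

lemma measurable_matrix_functional:
  fixes V :: "'a \<Rightarrow> complex ^ 'd ^ 'd"
  shows "V \<in> borel_measurable M \<Longrightarrow> (\<lambda>x. Re (cinner (V x *v e) e)) \<in> borel_measurable M"
proof -
  have "continuous_on UNIV (\<lambda>A :: complex ^ 'd ^ 'd. Re (cinner (A *v e) e))"
    unfolding cinner_def matrix_vector_mult_def by (intro continuous_intros)
  then have "(\<lambda>A :: complex ^ 'd ^ 'd. Re (cinner (A *v e) e)) \<in> borel_measurable borel"
    by (rule borel_measurable_continuous_onI)
  then show "V \<in> borel_measurable M \<Longrightarrow> ?thesis"
    by (rule measurable_compose[rotated])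
qed

lemma qform_powr_integrable:
  assumes V: "matrix_weight V" and int: "locally_integrable (\<lambda>x. op_norm (V x) powr p)"
    and p: "0 \<le> p" and Q: "cube Q"
  shows "set_integrable lebesgue Q (\<lambda>x. qform V e x powr p)"
proof -
  have "set_integrable lebesgue Q (\<lambda>x. op_norm (V x) powr p)"
    using int cube_facts(2)[OF Q] by (simp add: locally_integrable_def)
  then have "set_integrable lebesgue Q (\<lambda>x. ((norm e)\<^sup>2) powr p * op_norm (V x) powr p)"
    by (rule set_integrable_mult_right)
  then show ?thesis
    unfolding set_integrable_def
  proof (rule Bochner_Integration.integrable_bound)
    have "qform V e \<in> borel_measurable lebesgue"
      using V measurable_matrix_functional[of V lebesgue e] by (simp add: matrix_weight_def qform_def[abs_def])
    then show "(\<lambda>x. indicator Q x *\<^sub>R qform V e x powr p) \<in> borel_measurable lebesgue"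
      using cube_facts(1)[OF Q] by measurable
    have "qform V e x powr p \<le> ((norm e)\<^sup>2) powr p * op_norm (V x) powr p" for x
    proof -
      have "qform V e x powr p \<le> (op_norm (V x) * (norm e)\<^sup>2) powr p"
        using qform_nonneg[OF V] qform_le p by (intro powr_mono2) auto
      then show ?thesis
        by (simp add: powr_mult op_norm_nonneg mult.commute)
    qed
    then show "AE x in lebesgue. norm (indicator Q x *\<^sub>R qform V e x powr p)
        \<le> norm (indicator Q x *\<^sub>R (((norm e)\<^sup>2) powr p * op_norm (V x) powr p))"
      by (intro AE_I2) (auto simp: indicator_def abs_mult)
  qed
qed

lemma op_norm_powr_1: "op_norm A powr 1 = op_norm A" for A :: "complex ^ 'd ^ 'd"
  using op_norm_nonneg[of A] by simp

lemma qform_powr_1: "matrix_weight V \<Longrightarrow> qform V e x powr 1 = qform V e x"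
  using qform_nonneg[of V e x] by simp

lemma qform_integrable:
  assumes V: "matrix_weight V" and Q: "cube Q"
  shows "set_integrable lebesgue Q (qform V e)"
proof -
  have "locally_integrable (\<lambda>x. op_norm (V x) powr 1)"
    using V by (simp only: matrix_weight_def op_norm_powr_1)
  then have "set_integrable lebesgue Q (\<lambda>x. qform V e x powr 1)"
    using V Q by (intro qform_powr_integrable) auto
  then show ?thesis by (simp only: qform_powr_1[OF V])
qed

text \<open>The integral of the matrix function commutes with the linear functional \<open>A \<mapsto> \<langle>Ae, e\<rangle>\<close>, since
the operator norm controls the entries and hence \<open>V\<close> is integrable over cubes.\<close>

lemma avg_qform:
  fixes V :: "real ^ 'n \<Rightarrow> complex ^ 'd ^ 'd"
  assumes V: "matrix_weight V" and Q: "cube Q"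
  shows "Re (cinner (avg Q V *v e) e) = avg Q (qform V e)"
proof -
  define F where "F A = Re (cinner (A *v e) e)" for A :: "complex ^ 'd ^ 'd"
  have F: "bounded_linear F"
    unfolding F_def inner_eq_Re_cinner[symmetric] linear_conv_bounded_linear[symmetric]
  proof (rule linearI)
    show "((A + B) *v e) \<bullet> e = (A *v e) \<bullet> e + (B *v e) \<bullet> e" for A B
      by (simp add: matrix_vector_mult_add_rdistrib inner_add_left)
    show "((r *\<^sub>R A) *v e) \<bullet> e = r *\<^sub>R ((A *v e) \<bullet> e)" for r A
    proof -
      have "(r *\<^sub>R A) *v e = r *\<^sub>R (A *v e)"
        by (simp add: vec_eq_iff matrix_vector_mult_def scaleR_sum_right)
      then show ?thesis by simp
    qed
  qed
  have "set_integrable lebesgue Q (\<lambda>x. op_norm (V x))"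
    using V cube_facts(2)[OF Q] by (simp add: matrix_weight_def locally_integrable_def)
  then have "set_integrable lebesgue Q (\<lambda>x. sqrt (real CARD('d)) * op_norm (V x))"
    by (rule set_integrable_mult_right)
  then have int: "integrable lebesgue (\<lambda>x. indicator Q x *\<^sub>R V x)"
    unfolding set_integrable_def
  proof (rule Bochner_Integration.integrable_bound)
    have "V \<in> borel_measurable lebesgue" using V by (simp add: matrix_weight_def)
    then show "(\<lambda>x. indicator Q x *\<^sub>R V x) \<in> borel_measurable lebesgue"
      using cube_facts(1)[OF Q] by measurable
    show "AE x in lebesgue. norm (indicator Q x *\<^sub>R V x)
        \<le> norm (indicator Q x *\<^sub>R (sqrt (real CARD('d)) * op_norm (V x)))"
      using norm_matrix_le_op_norm
      by (intro AE_I2) (auto simp: indicator_def abs_mult op_norm_nonneg)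
  qed
  interpret F: bounded_linear F by (rule F)
  have "F (avg Q V) = (1 / measure lebesgue Q) * F (\<integral>x. indicator Q x *\<^sub>R V x \<partial>lebesgue)"
    by (simp add: avg_def set_lebesgue_integral_def F.scaleR)
  also have "F (\<integral>x. indicator Q x *\<^sub>R V x \<partial>lebesgue) = (\<integral>x. F (indicator Q x *\<^sub>R V x) \<partial>lebesgue)"
    by (rule integral_bounded_linear[OF F int, symmetric])
  also have "\<dots> = (LINT x:Q|lebesgue. qform V e x)"
    by (simp add: set_lebesgue_integral_def F.scaleR) (simp add: F_def qform_def)
  finally show ?thesis
    by (simp add: F_def avg_def)
qed

lemma weight_norm_1_sq:
  assumes "matrix_weight V" "cube Q"
  shows "(weight_norm V 1 Q e)\<^sup>2 = avg Q (qform V e)"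
  using avg_nonneg[OF assms(2), of "qform V e"] qform_nonneg[OF assms(1)]
  by (simp add: weight_norm_def qform_powr_1[OF assms(1)] powr_half_sqrt)

lemma weight_norm_sq:
  assumes "0 < p"
  shows "(weight_norm V p Q e)\<^sup>2 = avg Q (\<lambda>x. qform V e x powr p) powr (1 / p)"
proof -
  have "(weight_norm V p Q e)\<^sup>2
      = avg Q (\<lambda>x. qform V e x powr p) powr (1 / (2 * p) + 1 / (2 * p))"
    unfolding powr_add by (simp add: weight_norm_def power2_eq_square)
  also have "1 / (2 * p) + 1 / (2 * p) = 1 / p"
    using assms by (simp add: field_simps)
  finally show ?thesis .
qed

section \<open>Reducing matrices\<close>

lemma mat_powr_root:
  assumes "matrix_weight V" "0 < p"
  shows "mat_powr (mat_powr (V x) p) (1 / (2 * p)) = mat_powr (V x) (1 / 2)"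
  using assms by (simp add: matrix_weight_def mat_powr_mat_powr)

lemma norm_half_powr:
  assumes "matrix_weight V"
  shows "norm (mat_powr (V x) (1 / 2) *v e) powr (2 * p) = qform V e x powr p"
proof (cases "mat_powr (V x) (1 / 2) *v e = 0")
  case True
  then show ?thesis using qform_half[OF assms, of x e] by simp
next
  case False
  then have "(norm (mat_powr (V x) (1 / 2) *v e))\<^sup>2 = norm (mat_powr (V x) (1 / 2) *v e) powr 2"
    by simp
  then show ?thesis
    unfolding qform_half[OF assms, symmetric] by (simp only: powr_powr)
qed

text \<open>For a matrix weight \<open>V\<close> these are precisely the conditions under which \<open>V\<^sup>p\<close> is a matrix weight that
is nondegenerate for the exponent \<open>2p\<close>.\<close>

locale averaged_weight =
  fixes V :: "real ^ 'n \<Rightarrow> complex ^ 'd ^ 'd" and p :: real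
  assumes weight: "matrix_weight V"
    and p: "1 \<le> p"
    and local_int: "locally_integrable (\<lambda>x. op_norm (V x) powr p)"
    and nondeg: "e \<noteq> 0 \<Longrightarrow> AE x in lebesgue. 0 < qform V e x"
begin

lemma integrable: "cube Q \<Longrightarrow> set_integrable lebesgue Q (\<lambda>x. qform V e x powr p)"
  using qform_powr_integrable[OF weight local_int] p by simp

lemma avg_eq_weight_norm:
  "cube Q \<Longrightarrow> avg Q (\<lambda>x. qform V e x powr p) = weight_norm V p Q e powr (2 * p)"
  using p avg_nonneg[of Q "\<lambda>x. qform V e x powr p"] by (simp add: weight_norm_def powr_powr)

lemma weight_norm_pos:
  assumes "cube Q" "e \<noteq> 0"
  shows "0 < weight_norm V p Q e"
proof -
  have "AE x in lebesgue. 0 < qform V e x powr p"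
    using nondeg[OF assms(2)] by eventually_elim simp
  then have "0 < avg Q (\<lambda>x. qform V e x powr p)"
    using assms(1) by (intro avg_pos integrable) auto
  then show ?thesis by (simp add: weight_norm_def)
qed

lemma weight_norm_scale:
  assumes "cube Q"
  shows "weight_norm V p Q (z *s e) = norm z * weight_norm V p Q e"
proof -
  have "qform V (z *s e) x powr p = norm z powr (2 * p) * qform V e x powr p" for x
  proof -
    have "((norm z)\<^sup>2) powr p = norm z powr (2 * p)"
      by (cases "z = 0") (simp_all add: powr_powr flip: powr_numeral)
    then show ?thesis
      using qform_nonneg[OF weight] by (simp add: qform_scale powr_mult)
  qed
  then show ?thesis
    using p avg_nonneg[OF assms, of "\<lambda>x. qform V e x powr p"]
    by (simp add: weight_norm_def avg_cmult[OF assms] powr_mult powr_powr)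
qed

text \<open>Minkowski's inequality, from convexity: \<open>|V\<^bsup>1/2\<^esup>(a + b)| / (\<alpha> + \<beta>)\<close> is bounded by a convex combination
of \<open>|V\<^bsup>1/2\<^esup>a| / \<alpha>\<close> and \<open>|V\<^bsup>1/2\<^esup>b| / \<beta>\<close>, whose \<open>2p\<close>-th powers have average one.\<close>

lemma weight_norm_triangle:
  assumes Q: "cube Q"
  shows "weight_norm V p Q (a + b) \<le> weight_norm V p Q a + weight_norm V p Q b"
proof (cases "a = 0 \<or> b = 0")
  case True
  have "0 \<le> weight_norm V p Q e" for e by (simp add: weight_norm_def)
  then show ?thesis using True by auto
next
  case False
  define \<alpha> where "\<alpha> = weight_norm V p Q a"
  define \<beta> where "\<beta> = weight_norm V p Q b"
  have pos: "0 < \<alpha>" "0 < \<beta>" using False weight_norm_pos[OF Q] by (auto simp: \<alpha>_def \<beta>_def)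
  define s where "s = \<alpha> / (\<alpha> + \<beta>)"
  have s: "0 \<le> s" "s \<le> 1" using pos by (auto simp: s_def)
  have s': "1 - s = \<beta> / (\<alpha> + \<beta>)" using pos by (simp add: s_def field_simps)
  define c1 where "c1 = (\<alpha> + \<beta>) powr (2 * p) * (s / \<alpha> powr (2 * p))"
  define c2 where "c2 = (\<alpha> + \<beta>) powr (2 * p) * ((1 - s) / \<beta> powr (2 * p))"
  have pointwise: "qform V (a + b) x powr p \<le> c1 * qform V a x powr p + c2 * qform V b x powr p" for x
  proof -
    define N where "N e = norm (mat_powr (V x) (1 / 2) *v e)" for e
    have N: "qform V e x powr p = N e powr (2 * p)" for e
      by (simp add: N_def norm_half_powr[OF weight])
    have N0: "0 \<le> N e" for e by (simp add: N_def)
    have "N (a + b) \<le> N a + N b"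
      by (simp add: N_def matrix_vector_right_distrib norm_triangle_ineq)
    also have "\<dots> = (\<alpha> + \<beta>) * s * (N a / \<alpha>) + (\<alpha> + \<beta>) * (1 - s) * (N b / \<beta>)"
      unfolding s' using pos by (simp add: s_def)
    also have "\<dots> = (\<alpha> + \<beta>) * (s * (N a / \<alpha>) + (1 - s) * (N b / \<beta>))"
      by (simp only: distrib_left mult.assoc)
    finally have "N (a + b) powr (2 * p)
        \<le> ((\<alpha> + \<beta>) * (s * (N a / \<alpha>) + (1 - s) * (N b / \<beta>))) powr (2 * p)"
      using N0 p by (intro powr_mono2) auto
    also have "\<dots> = (\<alpha> + \<beta>) powr (2 * p) * (s * (N a / \<alpha>) + (1 - s) * (N b / \<beta>)) powr (2 * p)"
      using pos s N0 by (intro powr_mult)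
    also have "\<dots> \<le> (\<alpha> + \<beta>) powr (2 * p) * (s * (N a / \<alpha>) powr (2 * p) + (1 - s) * (N b / \<beta>) powr (2 * p))"
      using pos s N0 p by (intro mult_left_mono powr_convex_combination) auto
    also have "\<dots> = c1 * N a powr (2 * p) + c2 * N b powr (2 * p)"
      using pos N0 by (simp add: c1_def c2_def powr_divide algebra_simps)
    finally show ?thesis by (simp add: N)
  qed
  have "avg Q (\<lambda>x. qform V (a + b) x powr p) \<le> avg Q (\<lambda>x. c1 * qform V a x powr p + c2 * qform V b x powr p)"
    using integrable[OF Q] pointwise by (intro avg_mono[OF Q] set_integral_add set_integrable_mult_right)
  also have "\<dots> = c1 * avg Q (\<lambda>x. qform V a x powr p) + c2 * avg Q (\<lambda>x. qform V b x powr p)"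
    using integrable[OF Q] by (simp only: avg_add[OF Q] avg_cmult[OF Q] set_integrable_mult_right)
  also have "\<dots> = c1 * \<alpha> powr (2 * p) + c2 * \<beta> powr (2 * p)"
    by (simp only: avg_eq_weight_norm[OF Q] \<alpha>_def \<beta>_def)
  also have "\<dots> = (\<alpha> + \<beta>) powr (2 * p) * s + (\<alpha> + \<beta>) powr (2 * p) * (1 - s)"
    using pos by (simp add: c1_def c2_def)
  also have "\<dots> = (\<alpha> + \<beta>) powr (2 * p)"
    by (simp add: right_diff_distrib)
  finally have "weight_norm V p Q (a + b) powr (2 * p) \<le> (\<alpha> + \<beta>) powr (2 * p)"
    by (simp only: avg_eq_weight_norm[OF Q])
  then show ?thesis
    using pos p unfolding \<alpha>_def[symmetric] \<beta>_def[symmetric]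
    by (smt (verit) powr_less_mono2)
qed

lemma is_reducing_matrix_iff:
  "is_reducing_matrix (2 * p) (\<lambda>x. mat_powr (V x) p) Q R \<longleftrightarrow> pos_def R \<and>
    (\<forall>e. weight_norm V p Q e \<le> norm (R *v e) \<and> norm (R *v e) \<le> sqrt (real CARD('d)) * weight_norm V p Q e)"
  using p by (simp add: is_reducing_matrix_def mat_powr_root[OF weight] norm_half_powr[OF weight] weight_norm_def)

lemma reducing_matrix:
  fixes Q defines "R \<equiv> reducing_matrix (2 * p) (\<lambda>x. mat_powr (V x) p) Q"
  assumes Q: "cube Q"
  shows "pos_def R" "weight_norm V p Q e \<le> norm (R *v e)"
    "norm (R *v e) \<le> sqrt (real CARD('d)) * weight_norm V p Q e"
proof -
  interpret complex_norm "weight_norm V p Q"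
    using Q by unfold_locales (auto simp: weight_norm_triangle weight_norm_scale weight_norm_pos)
  have "\<exists>R. is_reducing_matrix (2 * p) (\<lambda>x. mat_powr (V x) p) Q R"
    unfolding is_reducing_matrix_iff by (rule john_ellipsoid)
  then have "is_reducing_matrix (2 * p) (\<lambda>x. mat_powr (V x) p) Q R"
    unfolding R_def reducing_matrix_def by (rule someI_ex)
  then show "pos_def R" "weight_norm V p Q e \<le> norm (R *v e)"
    "norm (R *v e) \<le> sqrt (real CARD('d)) * weight_norm V p Q e"
    unfolding is_reducing_matrix_iff by auto
qed

end

lemma weight_norm_mono:
  assumes "averaged_weight V p" and Q: "cube Q"
  shows "weight_norm V 1 Q e \<le> weight_norm V p Q e"
proof -
  interpret averaged_weight V p by fact
  have "avg Q (qform V e) powr p \<le> avg Q (\<lambda>x. qform V e x powr p)"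
    using qform_integrable[OF weight Q] integrable[OF Q] qform_nonneg[OF weight] p
    by (intro avg_powr_jensen[OF Q])
  then have "(avg Q (qform V e) powr p) powr (1 / p) \<le> (weight_norm V p Q e)\<^sup>2"
    using p by (subst weight_norm_sq) (auto intro!: powr_mono2)
  then have "(weight_norm V 1 Q e)\<^sup>2 \<le> (weight_norm V p Q e)\<^sup>2"
    using p avg_nonneg[OF Q, of "qform V e"] qform_nonneg[OF weight]
    by (simp add: powr_powr weight_norm_1_sq[OF weight Q])
  then show ?thesis
    by (rule power2_le_imp_le) (simp add: weight_norm_def)
qed

section \<open>The equivalence\<close>

text \<open>Jensen's inequality for the determinant. With \<open>T = S\<^bsup>-1\<^esup>\<close>, the logarithm of \<open>|det (V\<^bsup>1/2\<^esup>T)|\<close> is at most half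
of \<open>\<Sum>\<^sub>i |V\<^bsup>1/2\<^esup>Te\<^sub>i|\<^sup>2 - d\<close>, whose average is nonpositive because \<open>avg |V\<^bsup>1/2\<^esup>Te\<^sub>i|\<^sup>2 \<le> |STe\<^sub>i|\<^sup>2 = 1\<close>.\<close>

lemma exp_avg_ln_det_le:
  fixes V :: "real ^ 'n \<Rightarrow> complex ^ 'd ^ 'd"
  assumes V: "matrix_weight V" and Q: "cube Q" and S: "pos_def S"
    and le: "\<And>e. weight_norm V 1 Q e \<le> norm (S *v e)"
  shows "exp_avg_ln_det Q (\<lambda>x. mat_powr (V x) (1 / 2)) \<le> norm (det S)"
proof -
  define B where "B x = mat_powr (V x) (1 / 2)" for x
  have psd: "pos_semidef (B x)" for x
    using V by (simp add: B_def matrix_weight_def pos_semidef_mat_powr)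
  have norm_det: "norm (det (B x)) = Re (det (B x))" for x
    using det_pos_semidef[OF psd[of x]] by (metis Re_complex_of_real)
  show ?thesis
  proof (cases "(AE x in lebesgue. x \<in> Q \<longrightarrow> 0 < Re (det (B x))) \<and>
               set_integrable lebesgue Q (\<lambda>x. ln (Re (det (B x))))")
    case False
    then show ?thesis unfolding exp_avg_ln_det_def B_def by (simp only: if_False norm_ge_zero)
  next
    case True
    have S0: "det S \<noteq> 0" using det_pos_def[OF S] by blast
    obtain T where T: "S ** T = mat 1" "T ** S = mat 1"
      using det_nonzero_inverse[OF S0] by blast
    let ?t = "\<lambda>i. T *v axis i 1"
    define g where "g x = (\<Sum>i\<in>UNIV. qform V (?t i) x)" for x
    have g_int: "set_integrable lebesgue Q g"
      unfolding g_def using qform_integrable[OF V Q] by (intro avg_sum[OF Q]) auto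
    have "avg Q g = (\<Sum>i\<in>UNIV. (weight_norm V 1 Q (?t i))\<^sup>2)"
      unfolding g_def using qform_integrable[OF V Q]
      by (subst avg_sum[OF Q]) (auto simp: weight_norm_1_sq[OF V Q])
    also have "\<dots> \<le> (\<Sum>i\<in>(UNIV :: 'd set). 1)"
    proof (rule sum_mono)
      fix i
      have "weight_norm V 1 Q (?t i) \<le> 1"
        using le[of "?t i"] by (simp add: matrix_vector_mul_assoc T)
      then show "(weight_norm V 1 Q (?t i))\<^sup>2 \<le> 1"
        by (intro power_le_one) (auto simp: weight_norm_def)
    qed
    finally have g_le: "avg Q g \<le> real CARD('d)" by simp
    have "ln (Re (det (B x))) \<le> (ln (norm (det S)) - real CARD('d) / 2) + (1 / 2) * g x"
      if "0 < Re (det (B x))" for x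
    proof -
      have "norm (det T) * norm (det S) = 1"
        using T(2) by (metis det_I det_mul norm_mult norm_one)
      then have T0: "det T \<noteq> 0"
        by auto
      have "ln (norm (det T)) + ln (norm (det S)) = ln (norm (det T) * norm (det S))"
        using T0 S0 by (simp add: ln_mult)
      also have "\<dots> = 0"
        using \<open>norm (det T) * norm (det S) = 1\<close> by simp
      finally have "ln (norm (det (B x ** T))) = ln (Re (det (B x))) - ln (norm (det S))"
        using that T0 by (simp add: det_mul norm_mult ln_mult norm_det)
      moreover have "det (B x ** T) \<noteq> 0"
        using T0 that by (auto simp: det_mul)
      then have "2 * ln (norm (det (B x ** T))) \<le> g x - real CARD('d)"
        using ln_norm_det_le[of "B x ** T"]
        by (simp add: g_def B_def qform_half[OF V] flip: matrix_vector_mul_assoc)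
      ultimately show ?thesis by simp
    qed
    then have "avg Q (\<lambda>x. ln (Re (det (B x))))
        \<le> avg Q (\<lambda>x. (ln (norm (det S)) - real CARD('d) / 2) + (1 / 2) * g x)"
      using True g_int integrable_cube_const[OF Q]
      by (intro avg_mono_AE[OF Q] set_integral_add set_integrable_mult_right) auto
    also have "\<dots> = (ln (norm (det S)) - real CARD('d) / 2) + (1 / 2) * avg Q g"
      using g_int integrable_cube_const[OF Q]
      by (simp only: avg_add[OF Q] avg_cmult[OF Q] avg_const[OF Q] set_integrable_mult_right)
    also have "\<dots> \<le> ln (norm (det S))"
      using g_le by simp
    finally have "exp (avg Q (\<lambda>x. ln (Re (det (B x))))) \<le> norm (det S)"
      using S0 by (simp add: ln_ge_iff)
    then show ?thesis
      using True unfolding exp_avg_ln_det_def B_def by (simp only: if_True simp_thms)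
  qed
qed

lemma nondegenerate_iff:
  assumes "matrix_weight V" "0 < p"
  shows "nondegenerate (2 * p) (\<lambda>x. mat_powr (V x) p)
    \<longleftrightarrow> (\<forall>e. e \<noteq> 0 \<longrightarrow> (AE x in lebesgue. 0 < qform V e x))"
proof -
  have "0 < norm (mat_powr (V x) (1 / 2) *v e) \<longleftrightarrow> 0 < qform V e x" for x e
    by (simp flip: qform_half[OF assms(1)])
  then show ?thesis
    by (simp only: nondegenerate_def mat_powr_root[OF assms])
qed

lemma matrix_weight_powr:
  assumes V: "matrix_weight V" and p: "0 < p"
  shows "matrix_weight (\<lambda>x. mat_powr (V x) p) \<longleftrightarrow> locally_integrable (\<lambda>x. op_norm (V x) powr p)"
  using V p by (auto simp: matrix_weight_def op_norm_mat_powr pos_semidef_mat_powr mat_powr_measurable)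

text \<open>Applied to \<open>p\<close> and to \<open>1\<close>, this makes the two conditions differ only in the reducing matrix and in
the exponent of local integrability.\<close>

lemma A_inf_powr_iff:
  assumes V: "matrix_weight V" and p: "1 \<le> p"
  shows "A_inf (2 * p) (\<lambda>x. mat_powr (V x) p) \<longleftrightarrow> averaged_weight V p \<and>
    (\<exists>A>0. \<forall>Q. cube Q \<longrightarrow>
      norm (det (reducing_matrix (2 * p) (\<lambda>x. mat_powr (V x) p) Q))
        \<le> A * exp_avg_ln_det Q (\<lambda>x. mat_powr (V x) (1 / 2)))"
proof -
  have "matrix_weight (\<lambda>x. mat_powr (V x) p) \<and> nondegenerate (2 * p) (\<lambda>x. mat_powr (V x) p)
      \<longleftrightarrow> averaged_weight V p"
    using p by (simp add: matrix_weight_powr[OF V] nondegenerate_iff[OF V] averaged_weight_def V)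
  moreover have "Re (det (reducing_matrix (2 * p) (\<lambda>x. mat_powr (V x) p) Q))
      = norm (det (reducing_matrix (2 * p) (\<lambda>x. mat_powr (V x) p) Q))"
    if "averaged_weight V p" "cube Q" for Q
    using det_pos_def(1)[OF averaged_weight.reducing_matrix(1)[OF that]] by (metis Re_complex_of_real)
  ultimately show ?thesis
    using p unfolding A_inf_def mat_powr_root[OF V order.strict_trans2[OF zero_less_one p]]
    by (auto 0 4)
qed

theorem propositionB12:
  fixes V :: "real ^ 'n \<Rightarrow> complex ^ 'd ^ 'd" and p :: real
  assumes "1 < p" and "matrix_weight V" and "ND V"
  shows "A_inf (2 * p) (\<lambda>x. mat_powr (V x) p) \<longleftrightarrow> A_inf 2 V \<and> B_class p V"
proof -
  note V = \<open>matrix_weight V\<close>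
  have p: "1 \<le> p" using assms(1) by simp
  define d where "d = sqrt (real CARD('d))"
  have d: "0 < d" "d\<^sup>2 = real CARD('d)" by (auto simp: d_def)
  define E where "E Q = exp_avg_ln_det Q (\<lambda>x. mat_powr (V x) (1 / 2))" for Q
  define R where "R Q = reducing_matrix (2 * p) (\<lambda>x. mat_powr (V x) p) Q" for Q
  define S where "S Q = reducing_matrix 2 V Q" for Q
  have V1: "(\<lambda>x. mat_powr (V x) 1) = V"
    using V by (simp add: matrix_weight_def mat_powr_1)
  have Ap: "A_inf (2 * p) (\<lambda>x. mat_powr (V x) p) \<longleftrightarrow> averaged_weight V p \<and>
      (\<exists>A>0. \<forall>Q. cube Q \<longrightarrow> norm (det (R Q)) \<le> A * E Q)"
    unfolding R_def E_def by (rule A_inf_powr_iff[OF V p])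
  have A2: "A_inf 2 V \<longleftrightarrow> averaged_weight V 1 \<and> (\<exists>A>0. \<forall>Q. cube Q \<longrightarrow> norm (det (S Q)) \<le> A * E Q)"
    using A_inf_powr_iff[OF V, of 1] by (simp add: V1 S_def E_def)
  have weight_1: "averaged_weight V 1" if "averaged_weight V p"
  proof -
    interpret averaged_weight V p by fact
    show ?thesis
      using V nondeg by unfold_locales (auto simp: matrix_weight_def op_norm_nonneg)
  qed
  have R: "pos_def (R Q)" "weight_norm V p Q e \<le> norm (R Q *v e)" "norm (R Q *v e) \<le> d * weight_norm V p Q e"
    if "averaged_weight V p" "cube Q" for Q e
    using averaged_weight.reducing_matrix[OF that] by (auto simp: R_def d_def)
  have S: "pos_def (S Q)" "weight_norm V 1 Q e \<le> norm (S Q *v e)" "norm (S Q *v e) \<le> d * weight_norm V 1 Q e"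
    if "averaged_weight V 1" "cube Q" for Q e
    using averaged_weight.reducing_matrix[OF that] by (auto simp: S_def d_def V1)
  show ?thesis
  proof
    assume "A_inf (2 * p) (\<lambda>x. mat_powr (V x) p)"
    then obtain A where wp: "averaged_weight V p" and A: "0 < A"
      and RE: "\<And>Q. cube Q \<Longrightarrow> norm (det (R Q)) \<le> A * E Q"
      unfolding Ap by blast
    note w1 = weight_1[OF wp]
    have SR: "norm (S Q *v e) \<le> d * norm (R Q *v e)" if Q: "cube Q" for Q e
    proof -
      have "norm (S Q *v e) \<le> d * weight_norm V 1 Q e"
        by (rule S[OF w1 Q])
      also have "\<dots> \<le> d * norm (R Q *v e)"
        using d weight_norm_mono[OF wp Q, of e] R(2)[OF wp Q, of e] by simp
      finally show ?thesis .
    qed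
    have "norm (det (S Q)) \<le> (d ^ CARD('d) * A) * E Q" if Q: "cube Q" for Q
    proof -
      have "norm (det (S Q)) \<le> d ^ CARD('d) * norm (det (R Q))"
        using det_pos_def(2)[OF R(1)[OF wp Q]] SR[OF Q] d by (intro norm_det_mono) auto
      also have "\<dots> \<le> d ^ CARD('d) * (A * E Q)"
        using d RE[OF Q] by (intro mult_left_mono) auto
      finally show ?thesis by simp
    qed
    then have "A_inf 2 V"
      unfolding A2 using w1 A d by (intro conjI exI[of _ "d ^ CARD('d) * A"]) auto
    moreover have "B_class p V"
    proof -
      define K where "K = A * d ^ (CARD('d) - 1)"
      have K: "0 < K" using A d by (simp add: K_def)
      have "avg Q (\<lambda>x. Re (cinner (V x *v e) e) powr p) powr (1 / p)
          \<le> (K * d)\<^sup>2 * Re (cinner (avg Q V *v e) e)" if Q: "cube Q" for Q e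
      proof -
        have "E Q \<le> norm (det (S Q))"
          unfolding E_def by (rule exp_avg_ln_det_le[OF V Q S(1,2)[OF w1 Q]])
        then have "norm (det (R Q)) \<le> A * norm (det (S Q))"
          using RE[OF Q] A by (meson mult_left_mono less_imp_le order_trans)
        then have "norm (R Q *v e) \<le> K * norm (S Q *v e)"
          unfolding K_def using det_pos_def(2)[OF S(1)[OF w1 Q]] SR[OF Q] d
          by (intro norm_le_of_det_le) auto
        also have "\<dots> \<le> K * (d * weight_norm V 1 Q e)"
          using K S(3)[OF w1 Q, of e] by simp
        finally have "weight_norm V p Q e \<le> K * d * weight_norm V 1 Q e"
          using R(2)[OF wp Q, of e] by (simp add: mult.assoc)
        then have "(weight_norm V p Q e)\<^sup>2 \<le> (K * d * weight_norm V 1 Q e)\<^sup>2"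
          by (intro power_mono) (auto simp: weight_norm_def)
        also have "\<dots> = (K * d)\<^sup>2 * Re (cinner (avg Q V *v e) e)"
          by (simp add: power_mult_distrib weight_norm_1_sq[OF V Q] avg_qform[OF V Q])
        finally show ?thesis
          using p by (subst (asm) weight_norm_sq) (auto simp: qform_def)
      qed
      then show ?thesis
        unfolding B_class_def using V wp K d
        by (intro conjI exI[of _ "(K * d)\<^sup>2"]) (auto simp: matrix_weight_def averaged_weight_def)
    qed
    ultimately show "A_inf 2 V \<and> B_class p V" ..
  next
    assume asm: "A_inf 2 V \<and> B_class p V"
    then obtain A where w1: "averaged_weight V 1" and A: "0 < A"
      and SE: "\<And>Q. cube Q \<Longrightarrow> norm (det (S Q)) \<le> A * E Q"
      unfolding A2 by blast
    obtain C where C: "0 < C" and B: "\<And>Q e. cube Q \<Longrightarrow>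
        avg Q (\<lambda>x. Re (cinner (V x *v e) e) powr p) powr (1 / p) \<le> C * Re (cinner (avg Q V *v e) e)"
      using asm unfolding B_class_def by blast
    have wp: "averaged_weight V p"
      using w1 asm p by (simp add: averaged_weight_def B_class_def)
    define K where "K = d * sqrt C"
    have K: "0 < K" using C d by (simp add: K_def)
    have "norm (det (R Q)) \<le> (K ^ CARD('d) * A) * E Q" if Q: "cube Q" for Q
    proof -
      have RS: "norm (R Q *v e) \<le> K * norm (S Q *v e)" for e
      proof -
        have "(weight_norm V p Q e)\<^sup>2 \<le> C * (weight_norm V 1 Q e)\<^sup>2"
          using p B[OF Q, of e]
          by (subst weight_norm_sq) (auto simp: weight_norm_1_sq[OF V Q] avg_qform[OF V Q] simp flip: qform_def)
        also have "\<dots> = (sqrt C * weight_norm V 1 Q e)\<^sup>2"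
          using C by (simp add: power_mult_distrib)
        finally have "weight_norm V p Q e \<le> sqrt C * weight_norm V 1 Q e"
          by (rule power2_le_imp_le) (use C in \<open>simp add: weight_norm_def\<close>)
        also have "\<dots> \<le> sqrt C * norm (S Q *v e)"
          using C S(2)[OF w1 Q, of e] by simp
        finally have "d * weight_norm V p Q e \<le> K * norm (S Q *v e)"
          using d by (simp add: K_def mult.assoc)
        then show ?thesis
          using R(3)[OF wp Q, of e] by linarith
      qed
      have "norm (det (R Q)) \<le> K ^ CARD('d) * norm (det (S Q))"
        using det_pos_def(2)[OF S(1)[OF w1 Q]] RS K by (intro norm_det_mono) auto
      also have "\<dots> \<le> K ^ CARD('d) * (A * E Q)"
        using K SE[OF Q] by (intro mult_left_mono) auto
      finally show ?thesis by simp
    qed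
    then show "A_inf (2 * p) (\<lambda>x. mat_powr (V x) p)"
      unfolding Ap using wp A K by (intro conjI exI[of _ "K ^ CARD('d) * A"]) auto
  qed
qed

end
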